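(* Let $\Pi$ be a Gibbs partition with parameters $(\alpha,V)$, let $n,m\ge1$, and condition on the restriction of $\Pi$ to $[n]$ being a given partition into $j$ blocks with sizes $(n_1,\dots,n_j)$. For $i=1,\dots,j$ let $M_{i,m}$ be the number of integers among $n+1,\dots,n+m$ that fall in the $i$-th old block, and for $l=1,\dots,n+m$ let $O^{(n)}_{l,m}=\sum_{i:\,n_i\le l}1\{n_i+M_{i,m}=l\}$ be the number of old blocks of size $l$ after the allocation of the additional $m$ integers. Then the joint falling factorial moments of order $(r_1,\dots,r_{n+m})$ ($r_l$ nonnegative integers) of the vector $(O^{(n)}_{1,m},\dots,O^{(n)}_{n+m,m})$, given the initial allocation $n_1,\dots,n_j$, are $$\mathbb{E}\Big[\prod_{l=1}^{n+m}(O^{(n)}_{l,m})_{[r_l]}\Big]=\Big(\prod_{l=1}^{n+m}r_l!\Big)\sum_{(\Xi_{r_1},\dots,\Xi_{r_{n+m}})}\frac{m!\,\prod_{l=1}^{n+m}\prod_{\xi\in\Xi_{r_l}}(n_{\xi}-\alpha)_{l-n_{\xi}}}{\prod_{l=1}^{n+m}\prod_{\xi\in\Xi_{r_l}}(l-n_{\xi})!\;\big(m-\sum_l l r_l+\sum_l\sum_{\xi\in\Xi_{r_l}}n_\xi\big)!}$$ $$\times\sum_{k=0}^{m-\sum_l l r_l+\sum_l\sum_{\xi\in\Xi_{r_l}}n_\xi}\frac{V_{n+m,j+k}}{V_{n,j}}\,S^{-1,-\alpha,-(n-(j-\sum_l r_l)\alpha-\sum_l\sum_{\xi\in\Xi_{r_l}}n_\xi)}_{m-\sum_l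 l r_l+\sum_l\sum_{\xi\in\Xi_{r_l}}n_\xi,\;k},$$ where $\Xi_{r_1}=(\xi_1,\dots,\xi_{r_1}),\ \dots,\ \Xi_{r_{n+m}}=(\xi_{\sum_l r_l-r_{n+m}+1},\dots,\xi_{\sum_{l}r_l})$, and each $\Xi_{r_l}$ ranges over all the combinations of $r_l$ elements of $\{1,\dots,j\}$ whose elements $\xi$ satisfy $n_{\xi}\le l$. For $r_l=r$ for one given $l$ and $r_h=0$ for all $h\ne l$, this gives $$\mathbb{E}\big[(O^{(n)}_{l,m})_{[r]}\big]=r!\sum_{(\xi_1,\dots,\xi_r)}\frac{m!\,\prod_{i=1}^r(n_{\xi_i}-\alpha)_{l-n_{\xi_i}}}{\prod_{i=1}^r(l-n_{\xi_i})!\,(m-rl+\sum_{i=1}^r n_{\xi_i})!}\sum_{k=0}^{m-lr+\sum_{i=1}^r n_{\xi_i}}\frac{V_{n+m,j+k}}{V_{n,j}}\,S^{-1,-\alpha,-(n-(j-r)\alpha-\sum_{i=1}^r n_{\xi_i})}_{m-lr+\sum_{i=1}^r n_{\xi_i},\,k},$$ where $(\xi_1,\dots,\xi_r)$ ranges over the combinations of $r$ elements of $\{1,\dots,j\}$ with $n_{\xi_i}\le l$. (Expectations are conditional on the given partition of $[n]$.)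
   Context: Notation: $(x)_n=x(x+1)\cdots(x+n-1)$ ($(x)_0=1$); $(x)_{[n]}=x(x-1)\cdots(x-n+1)$ ($(x)_{[0]}=1$). A term in which the argument of a factorial in the denominator is negative (so that the inner sum over $k$ is empty) is read as zero. Gibbs partition with parameters $(\alpha,V)$: $\alpha\in(-\infty,1)$ and $V=(V_{n,k})_{1\le k\le n}$ are nonnegative weights with $V_{1,1}=1$ and $V_{n,k}=(n-k\alpha)V_{n+1,k}+V_{n+1,k+1}$; $\Pi$ is the exchangeable random partition of the positive integers such that for every $n$ and every partition $\{A_1,\dots,A_k\}$ of $[n]=\{1,\dots,n\}$, the restriction $\Pi_n$ of $\Pi$ to $[n]$ satisfies $\mathbb{P}(\Pi_n=\{A_1,\dots,A_k\})=V_{n,k}\prod_{i=1}^k(1-\alpha)_{|A_i|-1}$. Conditional setting: it is assumed $V_{n,j}>0$. Given $\Pi_n$ (with $j$ blocks of sizes $n_1,\dots,n_j$), a block of $\Pi_{n+m}$ is old if it meets $[n]$, new otherwise; the $i$-th old block is the one containing the $i$-th block of $\Pi_n$. The conditional probability that $\Pi_{n+m}$ equals a specified partition extending $\Pi_n$, in which the old blocks gain $m_1,\dots,m_j\ge0$ elements and there are $k$ new blocks of sizes $s_1,\dots,s_k\ge1$, is $\frac{V_{n+m,j+k}}{V_{n,j}}\prod_{i=1}^j(n_i-\alpha)_{m_i}\prod_{i=1}^k(1-\alpha)_{s_i-1}$. Generalized central Stirling numbers: $S^{-1,-\alpha}_{n,k}=\frac{n!}{k!}\sum_{(n_1,\dots,n_k)}\prod_{j=1}^k\frac{(1-\alpha)_{n_j-1}}{n_j!}$,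 the sum being over compositions of $n$ into $k$ positive parts ($S_{0,0}^{-1,-\alpha}=1$, $S_{n,0}^{-1,-\alpha}=0$ for $n\ge1$, $S_{n,k}^{-1,-\alpha}=0$ for $k>n$). Generalized non-central Stirling numbers: $S^{-1,-\alpha,\gamma}_{n,k}=\sum_{s=k}^n\binom ns S^{-1,-\alpha}_{s,k}(-\gamma)_{n-s}$.
   Formalization: The combinations Ξ_{r_1},…,Ξ_{r_{n+m}} are required to be pairwise disjoint (all ξ distinct); without this the joint formula fails, e.g. n=j=m=1, r_1=r_2=1, where the left side is 0 and the right side is (1−α)V_{2,1}/V_{1,1}. *)

theory Defs
  imports "HOL-Probability.Probability" "HOL-Combinatorics.Permutations"
begin

definition falling_fact :: "'a::comm_ring_1 \<Rightarrow> nat \<Rightarrow> 'a" where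
  "falling_fact x r = (\<Prod>i<r. x - of_nat i)"

text \<open>\<open>central_stirling \<alpha> n k\<close> is $S^{-1,-\alpha}_{n,k}$; a composition of \<open>n\<close> into \<open>k\<close> positive
  parts is a list. The conventions for \<open>k = 0\<close> and \<open>k > n\<close> are the values of the empty
  product and of the empty sum.\<close>

definition compositions :: "nat \<Rightarrow> nat \<Rightarrow> nat list set" where
  "compositions n k = {ns. length ns = k \<and> sum_list ns = n \<and> (\<forall>s\<in>set ns. 1 \<le> s)}"

definition central_stirling :: "real \<Rightarrow> nat \<Rightarrow> nat \<Rightarrow> real" where
  "central_stirling \<alpha> n k =
     fact n / fact k *
     (\<Sum>ns\<in>compositions n k. \<Prod>s\<leftarrow>ns. pochhammer (1 - \<alpha>) (s - 1) / fact s)"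

text \<open>\<open>noncentral_stirling \<alpha> \<gamma> n k\<close> is $S^{-1,-\alpha,\gamma}_{n,k}$.\<close>

definition noncentral_stirling :: "real \<Rightarrow> real \<Rightarrow> nat \<Rightarrow> nat \<Rightarrow> real" where
  "noncentral_stirling \<alpha> \<gamma> n k =
     (\<Sum>s=k..n. real (n choose s) * central_stirling \<alpha> s k * pochhammer (- \<gamma>) (n - s))"

definition restrict_partition :: "nat \<Rightarrow> nat set set \<Rightarrow> nat set set" where
  "restrict_partition n P = (\<inter>) {1..n} ` P - {{}}"

text \<open>The natural \<open>\<sigma>\<close>-algebra on the partitions of the positive integers is generated by the
  restrictions to \<open>{1..n}\<close>, so measurability is only required of the events below.\<close>

locale random_partition = prob_space M for M :: "'a measure" +
  fixes X :: "'a \<Rightarrow> nat set set"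
  assumes partition: "\<And>\<omega>. \<omega> \<in> space M \<Longrightarrow> partition_on {1..} (X \<omega>)"
    and measurable_restrict:
      "\<And>n P. partition_on {1..n} P \<Longrightarrow> {\<omega>\<in>space M. restrict_partition n (X \<omega>) = P} \<in> sets M"

locale exchangeable_random_partition = random_partition +
  assumes exchangeable:
    "\<And>n P \<sigma>. partition_on {1..n} P \<Longrightarrow> \<sigma> permutes {1..n} \<Longrightarrow>
       prob {\<omega>\<in>space M. restrict_partition n (X \<omega>) = (`) \<sigma> ` P} =
       prob {\<omega>\<in>space M. restrict_partition n (X \<omega>) = P}"

definition gibbs_weights :: "real \<Rightarrow> (nat \<Rightarrow> nat \<Rightarrow> real) \<Rightarrow> bool" where
  "gibbs_weights \<alpha> V \<longleftrightarrow>
     (\<forall>n k. 1 \<le> k \<longrightarrow> k \<le> n \<longrightarrow> 0 \<le> V n k) \<and>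
     V 1 1 = 1 \<and>
     (\<forall>n k. 1 \<le> k \<longrightarrow> k \<le> n \<longrightarrow>
        V n k = (real n - real k * \<alpha>) * V (n + 1) k + V (n + 1) (k + 1))"

locale gibbs_partition = exchangeable_random_partition +
  fixes \<alpha> :: real and V :: "nat \<Rightarrow> nat \<Rightarrow> real"
  assumes alpha_less_1: "\<alpha> < 1"
    and weights: "gibbs_weights \<alpha> V"
    and prob_restrict:
      "\<And>n P. 1 \<le> n \<Longrightarrow> partition_on {1..n} P \<Longrightarrow>
         prob {\<omega>\<in>space M. restrict_partition n (X \<omega>) = P} =
         V n (card P) * (\<Prod>A\<in>P. pochhammer (1 - \<alpha>) (card A - 1))"

text \<open>The law conditional on the event that the restriction to \<open>{1..n}\<close> is the partition \<open>P\<close>;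
  conditional expectations are integrals with respect to it.\<close>

definition conditional_law ::
    "'a measure \<Rightarrow> ('a \<Rightarrow> nat set set) \<Rightarrow> nat \<Rightarrow> nat set set \<Rightarrow> 'a measure" where
  "conditional_law M X n P =
     uniform_measure M {\<omega>\<in>space M. restrict_partition n (X \<omega>) = P}"

text \<open>In the following, \<open>P\<close> is a partition of the positive integers and \<open>B 1, \<dots>, B j\<close> are the
  blocks of its restriction to \<open>{1..n}\<close>. For any other \<open>P\<close> the value of \<open>old_block\<close> may be
  arbitrary; such \<open>P\<close> are excluded by the conditioning.\<close>

definition old_block :: "nat \<Rightarrow> nat \<Rightarrow> (nat \<Rightarrow> nat set) \<Rightarrow> nat set set \<Rightarrow> nat \<Rightarrow> nat set" where
  "old_block n m B P i = (THE C. C \<in> restrict_partition (n + m) P \<and> B i \<subseteq> C)"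

definition old_gain :: "nat \<Rightarrow> nat \<Rightarrow> (nat \<Rightarrow> nat set) \<Rightarrow> nat set set \<Rightarrow> nat \<Rightarrow> nat" where
  "old_gain n m B P i = card (old_block n m B P i \<inter> {n+1..n+m})"

definition num_old_blocks ::
    "nat \<Rightarrow> nat \<Rightarrow> nat \<Rightarrow> (nat \<Rightarrow> nat set) \<Rightarrow> nat \<Rightarrow> nat set set \<Rightarrow> nat" where
  "num_old_blocks n m j B l P =
     (\<Sum>i\<in>{i\<in>{1..j}. card (B i) \<le> l}. of_bool (card (B i) + old_gain n m B P i = l))"

definition admissible :: "nat \<Rightarrow> (nat \<Rightarrow> nat set) \<Rightarrow> nat \<Rightarrow> nat \<Rightarrow> nat set set" where
  "admissible j B l r = {\<Xi>. \<Xi> \<subseteq> {1..j} \<and> card \<Xi> = r \<and> (\<forall>\<xi>\<in>\<Xi>. card (B \<xi>) \<le> l)}"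

text \<open>The members of a family are pairwise disjoint: the indices \<open>\<xi>\<close> of all combinations
  together are distinct, since one block cannot have two sizes at once.\<close>

definition admissible_families ::
    "nat \<Rightarrow> nat \<Rightarrow> (nat \<Rightarrow> nat set) \<Rightarrow> (nat \<Rightarrow> nat) \<Rightarrow> (nat \<Rightarrow> nat set) set" where
  "admissible_families L j B r =
     {\<Xi> \<in> (\<Pi>\<^sub>E l\<in>{1..L}. admissible j B l (r l)). disjoint_family_on \<Xi> {1..L}}"

end

theory Submission
  imports Defs "HOL-Computational_Algebra.Formal_Power_Series"
begin

text \<open>
  A falling factorial \<open>(O\<^sub>l)\<^bsub>[r]\<^esub>\<close> is \<open>r!\<close> times the number of \<open>r\<close>-subsets of the old blocks of
  size \<open>l\<close>; hence the moments reduce to the probabilities that the old blocks with index in a given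
  set \<open>S\<close> have prescribed sizes \<open>t i\<close>. Such a probability is a sum over the number of blocks of
  \<open>V\<close> times a total weight of extensions, and this total weight is found by induction on \<open>m\<close>: the
  point \<open>n + m + 1\<close> starts a new block, joins a block of \<open>S\<close> (weight \<open>t i - 1 - \<alpha>\<close>), or joins
  one of the other blocks, whose total weight depends only on their number and total size. The closed
  form satisfies the same recursion, because the factors \<open>(n\<^sub>i - \<alpha>)\<^sub>g / g!\<close> do so trivially and the
  non-central Stirling numbers obey a triangular recursion. The latter is the differential equation
  \<open>(1 - x) F' = (c - k \<alpha>) F + k f\<^bsup>k - 1\<^esup> (1 - x)\<^bsup>- c\<^esup>\<close> for their generating function
  \<open>F = f\<^bsup>k\<^esup> (1 - x)\<^bsup>- c\<^esup>\<close>, where \<open>(1 - x) f' = 1 - \<alpha> f\<close>.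
\<close>

section \<open>Recursion for non-central Stirling numbers\<close>

unbundle no vec_syntax
unbundle fps_syntax

text \<open>The exponential generating function of the block weights. In closed form it is (1 - (1 -
  x)^\<alpha>) / \<alpha>, or -log(1 - x) if \<alpha> = 0; giving the coefficients treats both cases
  alike.\<close>

definition block_fps :: "real \<Rightarrow> real fps" where
  "block_fps \<alpha> = Abs_fps (\<lambda>s. if s = 0 then 0 else pochhammer (1 - \<alpha>) (s - 1) / fact s)"

text \<open>The binomial series (1 - x)^(-c).\<close>

definition rising_fps :: "real \<Rightarrow> real fps" where
  "rising_fps c = Abs_fps (\<lambda>i. pochhammer c i / fact i)"

text \<open>A coefficient of a power is a sum over all lists of nonnegative entries
  (\<open>natpermute\<close>). Lists with an entry 0 contribute nothing, because
  \<open>block_fps\<close> has constant term 0; the compositions remain.\<close>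

lemma central_stirling_fps:
  "central_stirling \<alpha> n k = fact n / fact k * (block_fps \<alpha> ^ k) $ n"
proof (cases k)
  case 0
  have "compositions n 0 = (if n = 0 then {[]} else {})"
    by (auto simp: compositions_def)
  then show ?thesis
    using 0 by (simp add: central_stirling_def)
next
  case (Suc q)
  have fin: "finite (natpermute n k)"
    using Suc by (simp add: natpermute_finite)
  have "(\<Sum>ns\<in>compositions n k. \<Prod>s\<leftarrow>ns. pochhammer (1 - \<alpha>) (s - 1) / fact s)
      = (\<Sum>ns\<in>natpermute n k. \<Prod>i=0..q. block_fps \<alpha> $ (ns ! i))"
  proof (rule sum.mono_neutral_cong_left[OF fin])
    show "compositions n k \<subseteq> natpermute n k"
      by (auto simp: compositions_def natpermute_def)
    show "\<forall>ns\<in>natpermute n k - compositions n k. (\<Prod>i=0..q. block_fps \<alpha> $ (ns ! i)) = 0"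
    proof
      fix ns assume "ns \<in> natpermute n k - compositions n k"
      then have len: "length ns = k" and "\<exists>s\<in>set ns. s = 0"
        by (auto simp: compositions_def natpermute_def not_less_eq_eq)
      then obtain i where "i < k" "ns ! i = 0"
        by (metis in_set_conv_nth)
      then show "(\<Prod>i=0..q. block_fps \<alpha> $ (ns ! i)) = 0"
        using Suc by (auto simp: block_fps_def intro!: bexI[of _ i])
    qed
    fix ns assume "ns \<in> compositions n k"
    then have len: "length ns = k" and pos: "\<And>s. s \<in> set ns \<Longrightarrow> 1 \<le> s"
      by (auto simp: compositions_def)
    have "(\<Prod>s\<leftarrow>ns. pochhammer (1 - \<alpha>) (s - 1) / fact s)
        = (\<Prod>i<k. pochhammer (1 - \<alpha>) (ns ! i - 1) / fact (ns ! i))"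
      by (simp add: prod.list_conv_set_nth len atLeast0LessThan)
    also have "\<dots> = (\<Prod>i<k. block_fps \<alpha> $ (ns ! i))"
      by (rule prod.cong) (use pos len in \<open>fastforce simp: block_fps_def in_set_conv_nth\<close>)+
    also have "{..<k} = {0..q}"
      using Suc by auto
    finally show "(\<Prod>s\<leftarrow>ns. pochhammer (1 - \<alpha>) (s - 1) / fact s) = (\<Prod>i=0..q. block_fps \<alpha> $ (ns ! i))" .
  qed
  then show ?thesis
    using Suc by (simp add: central_stirling_def fps_power_nth_Suc del: power_Suc)
qed

text \<open>The binomial convolution in the definition is a product of exponential generating
  functions.\<close>

lemma noncentral_stirling_fps:
  "noncentral_stirling \<alpha> \<gamma> n k =
     fact n / fact k * (block_fps \<alpha> ^ k * rising_fps (- \<gamma>)) $ n"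
proof -
  have zero: "(block_fps \<alpha> ^ k) $ s = 0" if "s < k" for s
    using that startsby_zero_power_prefix[of "block_fps \<alpha>" k] by (simp add: block_fps_def)
  have "(block_fps \<alpha> ^ k * rising_fps (- \<gamma>)) $ n
      = (\<Sum>s=0..n. (block_fps \<alpha> ^ k) $ s * (rising_fps (- \<gamma>) $ (n - s)))"
    by (rule fps_mult_nth)
  \<comment> \<open>The \<open>k\<close>-th power of a series without constant term has no
    coefficients below \<open>k\<close>.\<close>
  also have "\<dots> = (\<Sum>s=k..n. (block_fps \<alpha> ^ k) $ s * (rising_fps (- \<gamma>) $ (n - s)))"
    by (rule sum.mono_neutral_right) (auto simp: zero)
  finally show ?thesis
    by (auto simp: noncentral_stirling_def central_stirling_fps rising_fps_def sum_distrib_left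
        binomial_fact field_simps intro!: sum.cong)
qed

text \<open>In closed form both sides are (1 - x)^\<alpha>. On coefficients the identity comes down
  to (1 - \<alpha>)_(q+1) = (1 - \<alpha>)_q (1 - \<alpha> + q).\<close>

lemma block_fps_deriv: "(1 - fps_X) * fps_deriv (block_fps \<alpha>) = 1 - fps_const \<alpha> * block_fps \<alpha>"
proof (rule fps_ext)
  fix n
  show "((1 - fps_X) * fps_deriv (block_fps \<alpha>)) $ n = (1 - fps_const \<alpha> * block_fps \<alpha>) $ n"
  proof (cases n)
    case 0
    then show ?thesis by (simp add: block_fps_def left_diff_distrib)
  next
    case (Suc q)
    show ?thesis
      by (simp add: Suc block_fps_def left_diff_distrib pochhammer_Suc field_simps del: fact_Suc)
        (simp add: field_simps)
  qed
qed

lemma rising_fps_deriv: "(1 - fps_X) * fps_deriv (rising_fps c) = fps_const c * rising_fps c"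
proof (rule fps_ext)
  fix n
  have rec: "real (Suc i) * rising_fps c $ Suc i = (c + real i) * rising_fps c $ i" for i
    by (simp add: rising_fps_def pochhammer_Suc del: of_nat_Suc)
  show "((1 - fps_X) * fps_deriv (rising_fps c)) $ n = (fps_const c * rising_fps c) $ n"
    using rec[of n] rec[of "n - 1"] by (cases n) (simp_all add: left_diff_distrib algebra_simps)
qed

text \<open>This is coefficient \<open>n\<close> of the differential equation for
  \<open>F k\<close>, with c = -\<gamma>; the prefactor \<open>fact n / fact k\<close> absorbs the
  factor \<open>k\<close> in front of \<open>F (k - 1)\<close>.\<close>

lemma noncentral_stirling_Suc:
  "noncentral_stirling \<alpha> \<gamma> (Suc n) k =
     (real n - \<gamma> - real k * \<alpha>) * noncentral_stirling \<alpha> \<gamma> n k +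
     (if k = 0 then 0 else noncentral_stirling \<alpha> \<gamma> n (k - 1))"
proof -
  define f where "f = block_fps \<alpha>"
  define r where "r = rising_fps (- \<gamma>)"
  define F where "F k = f ^ k * r" for k
  have "(1 - fps_X) * fps_deriv (F k) =
      of_nat k * f ^ (k - 1) * r * ((1 - fps_X) * fps_deriv f) + f ^ k * ((1 - fps_X) * fps_deriv r)"
    by (simp add: F_def fps_deriv_power' algebra_simps)
  also have "\<dots> = of_nat k * f ^ (k - 1) * r * (1 - fps_const \<alpha> * f) + f ^ k * (fps_const (- \<gamma>) * r)"
    by (simp add: f_def r_def block_fps_deriv rising_fps_deriv)
  \<comment> \<open>The case \<open>k = 0\<close> is separate because \<open>k - 1\<close> is
    truncated there; the factor \<open>of_nat k\<close> then removes the term.\<close>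
  also have "\<dots> = of_nat k * F (k - 1) - fps_const (real k * \<alpha> + \<gamma>) * F k"
    by (cases k) (simp_all add: F_def algebra_simps fps_of_nat[symmetric]
        flip: fps_const_mult fps_const_add fps_const_neg)
  finally have "((1 - fps_X) * fps_deriv (F k)) $ n
      = real k * F (k - 1) $ n - (real k * \<alpha> + \<gamma>) * F k $ n"
    by (simp add: fps_of_nat[symmetric])
  \<comment> \<open>The factor 1 - x subtracts coefficient \<open>n - 1\<close> of the derivative
    from coefficient \<open>n\<close>; this is the origin of the summand \<open>real n\<close> in
    the recursion.\<close>
  moreover have "((1 - fps_X) * fps_deriv (F k)) $ n = real (Suc n) * F k $ Suc n - real n * F k $ n"
    by (cases n) (simp_all add: left_diff_distrib)
  ultimately have rec: "real (Suc n) * F k $ Suc n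
      = (real n - \<gamma> - real k * \<alpha>) * F k $ n + real k * F (k - 1) $ n"
    by (simp add: algebra_simps)
  have ns: "noncentral_stirling \<alpha> \<gamma> i l = fact i / fact l * F l $ i" for i l
    by (simp add: noncentral_stirling_fps F_def f_def r_def)
  have "noncentral_stirling \<alpha> \<gamma> (Suc n) k = fact n / fact k * (real (Suc n) * F k $ Suc n)"
    by (simp add: ns)
  also have "\<dots> = (real n - \<gamma> - real k * \<alpha>) * (fact n / fact k * F k $ n)
      + fact n / fact k * real k * F (k - 1) $ n"
    unfolding rec by (simp only: distrib_left mult_ac)
  also have "fact n / fact k * real k * F (k - 1) $ n =
      (if k = 0 then 0 else noncentral_stirling \<alpha> \<gamma> n (k - 1))"
    by (cases k) (simp_all add: ns del: of_nat_Suc)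
  finally show ?thesis
    by (simp add: ns)
qed

lemma noncentral_stirling_0: "noncentral_stirling \<alpha> \<gamma> 0 k = of_bool (k = 0)"
  by (simp add: noncentral_stirling_fps block_fps_def rising_fps_def)

lemma noncentral_stirling_eq_0: "n < k \<Longrightarrow> noncentral_stirling \<alpha> \<gamma> n k = 0"
  by (simp add: noncentral_stirling_def)

section \<open>Adding a point to a partition\<close>

text \<open>\<open>C = {}\<close> is allowed and adds the singleton block \<open>{x}\<close>.\<close>

definition add_point :: "'a \<Rightarrow> 'a set set \<Rightarrow> 'a set \<Rightarrow> 'a set set" where
  "add_point x Q C = insert (insert x C) (Q - {C})"

lemma partition_on_add_point:
  assumes "partition_on A Q" "x \<notin> A" "C \<in> insert {} Q"
  shows "partition_on (insert x A) (add_point x Q C)"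
proof (rule partition_onI)
  show "\<Union> (add_point x Q C) = insert x A"
    using assms by (auto simp: add_point_def dest: partition_onD1)
  show "{} \<notin> add_point x Q C"
    using assms by (auto simp: add_point_def dest: partition_onD3)
  fix p q assume *: "p \<in> add_point x Q C" "q \<in> add_point x Q C" "p \<noteq> q"
  have disj: "D \<inter> E = {}" if "D \<in> insert {} Q" "E \<in> insert {} Q" "D \<noteq> E" for D E
    using that partition_onD2[OF assms(1)] by (auto simp: disjoint_def)
  have x: "x \<notin> D" if "D \<in> Q" for D
    using that assms by (auto dest: partition_onD1)
  show "disjnt p q"
    using * assms(3) disj x unfolding add_point_def disjnt_def by blast
qed

text \<open>The trace of \<open>insert x C\<close> on \<open>A\<close> is \<open>C\<close>; for
  \<open>C = {}\<close> this empty trace is what the final difference discards.\<close>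

lemma restrict_add_point:
  assumes "partition_on A Q" "x \<notin> A" "C \<in> insert {} Q"
  shows "(\<inter>) A ` add_point x Q C - {{}} = Q"
proof -
  have sub: "A \<inter> D = D" if "D \<in> insert {} Q" for D
    using that assms by (auto dest: partition_onD1)
  have "(\<inter>) A ` add_point x Q C = insert C ((\<inter>) A ` (Q - {C}))"
    using assms(2,3) sub[of C] by (auto simp: add_point_def)
  also have "(\<inter>) A ` (Q - {C}) = Q - {C}"
    using sub by force
  finally show ?thesis
    using assms(3) partition_onD3[OF assms(1)] by auto
qed

text \<open>With \<open>restrict_add_point\<close> this gives a bijection: a partition of
  \<open>insert x A\<close> amounts to its trace on \<open>A\<close> together with the rest
  \<open>D - {x}\<close> of the block of \<open>x\<close>, which is empty if \<open>x\<close> is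
  alone.\<close>

lemma partition_on_insert_eq_add_point:
  assumes "partition_on (insert x A) Q'" "x \<notin> A" "D \<in> Q'" "x \<in> D"
  defines "Q \<equiv> (\<inter>) A ` Q' - {{}}"
  shows "Q' = add_point x Q (D - {x})" "partition_on A Q" "D - {x} \<in> insert {} Q"
proof -
  have disj: "E \<inter> D = {}" if "E \<in> Q'" "E \<noteq> D" for E
    using that assms(3) partition_onD2[OF assms(1)] by (auto simp: disjoint_def)
  have sub: "A \<inter> E = E" if "E \<in> Q'" "E \<noteq> D" for E
  proof -
    have "E \<subseteq> insert x A"
      using that(1) unfolding partition_onD1[OF assms(1)] by (rule Union_upper)
    moreover have "x \<notin> E"
      using disj[OF that] assms(4) by blast
    ultimately show ?thesis
      by blast
  qed
  have D: "A \<inter> D = D - {x}"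
  proof -
    have "D \<subseteq> insert x A"
      using assms(3) unfolding partition_onD1[OF assms(1)] by (rule Union_upper)
    then show ?thesis
      using assms(2) by blast
  qed
  have Q: "Q = insert (D - {x}) (Q' - {D}) - {{}}"
  proof -
    have "(\<inter>) A ` Q' = insert (A \<inter> D) ((\<inter>) A ` (Q' - {D}))"
      using assms(3) by blast
    also have "(\<inter>) A ` (Q' - {D}) = Q' - {D}"
      using sub by force
    finally show ?thesis
      by (simp add: Q_def D)
  qed
  \<comment> \<open>Otherwise deleting \<open>D - {x}\<close> from \<open>Q\<close> would delete a
    second block of \<open>Q'\<close>.\<close>
  have "D - {x} \<notin> Q' - {D}"
  proof
    assume *: "D - {x} \<in> Q' - {D}"
    then have "(D - {x}) \<inter> D = {}"
      using disj[of "D - {x}"] by blast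
    then have "D - {x} = {}"
      by blast
    with * show False
      using partition_onD3[OF assms(1)] by simp
  qed
  then have "Q - {D - {x}} = Q' - {D}"
    using partition_onD3[OF assms(1)] by (auto simp: Q)
  then show "Q' = add_point x Q (D - {x})"
    using assms(3,4) by (auto simp: add_point_def insert_absorb)
  show "partition_on A Q"
    using partition_on_restrict[OF assms(1), of A] by (simp add: Q_def Int_absorb2 subset_insertI)
  show "D - {x} \<in> insert {} Q"
    by (auto simp: Q)
qed

lemma sum_partition_on_insert:
  fixes F :: "'a set set \<Rightarrow> 'b::comm_monoid_add"
  assumes "finite A" "x \<notin> A"
  shows "(\<Sum>Q' | partition_on (insert x A) Q'. F Q') =
    (\<Sum>Q | partition_on A Q. \<Sum>C\<in>insert {} Q. F (add_point x Q C))"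
proof -
  have fin: "finite Q" if "partition_on A Q" for Q
    using that assms(1) by (rule finite_elements[rotated])
  have "(\<Sum>Q | partition_on A Q. \<Sum>C\<in>insert {} Q. F (add_point x Q C)) =
      (\<Sum>(Q, C)\<in>Sigma {Q. partition_on A Q} (insert {}). F (add_point x Q C))"
    using fin assms(1) by (intro sum.Sigma) (auto intro: finitely_many_partition_on)
  also have "\<dots> = (\<Sum>Q' | partition_on (insert x A) Q'. F Q')"
  proof (rule sum.reindex_bij_witness[where
        \<comment> \<open>Exactly one block contains \<open>x\<close>, so the union of all such
          blocks names it.\<close>
        i = "\<lambda>Q'. ((\<inter>) A ` Q' - {{}}, \<Union>{D \<in> Q'. x \<in> D} - {x})" and
        j = "\<lambda>(Q, C). add_point x Q C"])
    fix QC assume "QC \<in> Sigma {Q. partition_on A Q} (insert {})"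
    then obtain Q C where QC: "QC = (Q, C)" "partition_on A Q" "C \<in> insert {} Q"
      by auto
    have "x \<notin> D" if "D \<in> insert {} Q" for D
      using that QC(2) assms(2) by (auto dest: partition_onD1)
    then have "{D \<in> add_point x Q C. x \<in> D} = {insert x C}" "x \<notin> C"
      using QC(3) by (auto simp: add_point_def)
    then show "(case case QC of (Q, C) \<Rightarrow> add_point x Q C of
        Q' \<Rightarrow> ((\<inter>) A ` Q' - {{}}, \<Union>{D \<in> Q'. x \<in> D} - {x})) = QC"
      using restrict_add_point[OF QC(2) assms(2) QC(3)] by (simp add: QC(1))
    show "(case QC of (Q, C) \<Rightarrow> add_point x Q C) \<in> {Q'. partition_on (insert x A) Q'}"
      using partition_on_add_point[OF QC(2) assms(2) QC(3)] by (simp add: QC(1))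
    show "F (case QC of (Q, C) \<Rightarrow> add_point x Q C) = (case QC of (Q, C) \<Rightarrow> F (add_point x Q C))"
      by (simp add: QC(1))
  next
    fix Q' assume "Q' \<in> {Q'. partition_on (insert x A) Q'}"
    then have Q': "partition_on (insert x A) Q'"
      by simp
    obtain D where D: "D \<in> Q'" "x \<in> D"
      using partition_onD1[OF Q'] by auto
    have "{E \<in> Q'. x \<in> E} = {D}"
      using D partition_onD2[OF Q'] by (auto simp: disjoint_def)
    then show "(case ((\<inter>) A ` Q' - {{}}, \<Union>{D \<in> Q'. x \<in> D} - {x}) of (Q, C) \<Rightarrow> add_point x Q C) = Q'"
      "((\<inter>) A ` Q' - {{}}, \<Union>{D \<in> Q'. x \<in> D} - {x}) \<in> Sigma {Q. partition_on A Q} (insert {})"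
      using partition_on_insert_eq_add_point[OF Q' assms(2) D] by auto
  qed
  finally show ?thesis ..
qed

section \<open>Restrictions to initial segments\<close>

lemma restrict_partition_restrict:
  "n \<le> N \<Longrightarrow> restrict_partition n (restrict_partition N P) = restrict_partition n P"
proof -
  assume "n \<le> N"
  then have "{1..n} \<inter> ({1..N} \<inter> D) = {1..n} \<inter> D" for D
    by auto
  moreover have "(\<inter>) {1..n} ` (R - {{}}) - {{}} = (\<inter>) {1..n} ` R - {{}}" for R
    by auto
  ultimately show ?thesis
    by (simp add: restrict_partition_def image_image)
qed

lemma partition_on_restrict_partition:
  "partition_on A P \<Longrightarrow> {1..N} \<subseteq> A \<Longrightarrow> partition_on {1..N} (restrict_partition N P)"
  using partition_on_restrict[of A P "{1..N}"] by (simp add: restrict_partition_def Int_absorb2)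

lemma restrict_partition_self:
  assumes "partition_on {1..N} Q"
  shows "restrict_partition N Q = Q"
proof -
  have "{1..N} \<inter> D = D" if "D \<in> Q" for D
    using that partition_onD1[OF assms] by auto
  then show ?thesis
    using partition_onD3[OF assms] by (auto simp: restrict_partition_def)
qed

text \<open>Restricting to \<open>{1..n}\<close> factors through \<open>{1..N}\<close>, where the
  new point is lost.\<close>

lemma restrict_partition_add_point:
  assumes "partition_on {1..N} Q" "C \<in> insert {} Q" "n \<le> N"
  shows "restrict_partition n (add_point (Suc N) Q C) = restrict_partition n Q"
proof -
  have "restrict_partition N (add_point (Suc N) Q C) = Q"
    using restrict_add_point[OF assms(1) _ assms(2)] by (simp add: restrict_partition_def)
  then show ?thesis
    using restrict_partition_restrict[OF assms(3)] by metis
qed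

section \<open>Weighted enumeration of extensions of a partition\<close>

text \<open>The factor of the Gibbs probability that does not involve \<open>V\<close>.\<close>

definition partition_weight :: "real \<Rightarrow> nat set set \<Rightarrow> real" where
  "partition_weight \<alpha> Q = (\<Prod>C\<in>Q. pochhammer (1 - \<alpha>) (card C - 1))"

lemma card_add_point:
  assumes "finite Q" "{} \<notin> Q" "x \<notin> \<Union>Q" "C \<in> insert {} Q"
  shows "card (add_point x Q C) = card Q + of_bool (C = {})"
proof -
  have "insert x C \<notin> Q - {C}"
    using assms(3) by auto
  then have "card (add_point x Q C) = Suc (card (Q - {C}))"
    using assms(1) by (simp add: add_point_def)
  also have "\<dots> = card Q + of_bool (C = {})"
    using assms(1,2,4) by (cases "C = {}") (auto simp: card_Suc_Diff1 simp del: card_Diff_insert)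
  finally show ?thesis .
qed

text \<open>When a block grows from size c to c + 1, its weight changes by (1 - \<alpha>)_c = (1 -
  \<alpha>)_(c-1) (c - \<alpha>); a new singleton has weight 1.\<close>

lemma partition_weight_add_point:
  assumes "finite Q" "{} \<notin> Q" "x \<notin> \<Union>Q" "C \<in> insert {} Q" "finite C"
  shows "partition_weight \<alpha> (add_point x Q C) =
    partition_weight \<alpha> Q * (if C = {} then 1 else real (card C) - \<alpha>)"
proof -
  have "insert x C \<notin> Q - {C}"
    using assms(3) by auto
  moreover have "x \<notin> C"
    using assms(3,4) by auto
  ultimately have eq: "partition_weight \<alpha> (add_point x Q C) =
      pochhammer (1 - \<alpha>) (card C) * partition_weight \<alpha> (Q - {C})"
    using assms(1,5) by (simp add: partition_weight_def add_point_def)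
  show ?thesis
  proof (cases "C = {}")
    case True
    then show ?thesis
      using assms(2) eq by simp
  next
    case False
    then have C: "C \<in> Q" and pos: "card C > 0"
      using assms(4,5) by (auto simp: card_gt_0_iff)
    have "pochhammer (1 - \<alpha>) (card C) = pochhammer (1 - \<alpha>) (card C - 1) * (real (card C) - \<alpha>)"
      using pos by (cases "card C") (simp_all add: pochhammer_Suc)
    then show ?thesis
      using False prod.remove[OF assms(1) C, of "\<lambda>C. pochhammer (1 - \<alpha>) (card C - 1)"]
      unfolding eq by (simp add: partition_weight_def mult_ac)
  qed
qed

text \<open>Both coefficients vanish at negative arguments, so that their recursions hold on all integers.\<close>

definition gain_coeff :: "real \<Rightarrow> int \<Rightarrow> real" where
  "gain_coeff c z = (if z < 0 then 0 else pochhammer c (nat z) / fact (nat z))"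

definition rest_coeff :: "real \<Rightarrow> real \<Rightarrow> int \<Rightarrow> nat \<Rightarrow> real" where
  "rest_coeff \<alpha> \<gamma> z k = (if z < 0 then 0 else noncentral_stirling \<alpha> \<gamma> (nat z) k / fact (nat z))"

text \<open>For positive \<open>z\<close> this is the recursion of the Pochhammer symbol over a
  factorial. At \<open>z = 0\<close> the left side vanishes by the cutoff and the right side by its
  factor \<open>z\<close>.\<close>

lemma gain_coeff_rec: "(c + of_int z - 1) * gain_coeff c (z - 1) = of_int z * gain_coeff c z"
proof (cases "z \<le> 0")
  case False
  then obtain q where q: "z = int (Suc q)"
    by (metis not_le pos_int_cases gr0_implies_Suc)
  show ?thesis
    by (simp add: q gain_coeff_def pochhammer_Suc nat_add_distrib del: of_nat_Suc)
      (simp add: field_simps)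
qed (auto simp: gain_coeff_def)

text \<open>For nonnegative \<open>z\<close> this is \<open>noncentral_stirling_Suc\<close> over a
  factorial. At \<open>z = - 1\<close> the left side vanishes by its factor and the right side by
  the cutoff.\<close>

lemma rest_coeff_rec:
  "of_int (z + 1) * rest_coeff \<alpha> \<gamma> (z + 1) k =
     (of_int z - \<gamma> - real k * \<alpha>) * rest_coeff \<alpha> \<gamma> z k +
     (if k = 0 then 0 else rest_coeff \<alpha> \<gamma> z (k - 1))"
proof (cases "z < 0")
  case True
  then show ?thesis
    by (cases "z = - 1") (auto simp: rest_coeff_def)
next
  case False
  define q where "q = nat z"
  have q: "z = int q"
    using False by (simp add: q_def)
  have "z + 1 = int (Suc q)"
    by (simp add: q)
  then have "of_int (z + 1) * rest_coeff \<alpha> \<gamma> (z + 1) k = noncentral_stirling \<alpha> \<gamma> (Suc q) k / fact q"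
    by (simp add: rest_coeff_def del: of_nat_Suc)
  then show ?thesis
    by (simp add: q rest_coeff_def noncentral_stirling_Suc add_divide_distrib)
qed

section \<open>Extensions of a fixed partition of \<open>{1..n}\<close> and their old blocks\<close>

locale initial_blocks =
  fixes n j :: nat and B :: "nat \<Rightarrow> nat set"
  assumes part: "partition_on {1..n} (B ` {1..j})" and inj: "inj_on B {1..j}"
begin

definition extensions :: "nat \<Rightarrow> nat set set set" where
  "extensions N = {Q. partition_on {1..N} Q \<and> restrict_partition n Q = B ` {1..j}}"

definition block :: "nat set set \<Rightarrow> nat \<Rightarrow> nat set" where
  "block Q i = (THE C. C \<in> Q \<and> B i \<subseteq> C)"

text \<open>Sizes are prescribed as integers so that \<open>t i - 1\<close> is never truncated; a
  negative size is simply not attained.\<close>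

definition has_sizes :: "nat set \<Rightarrow> (nat \<Rightarrow> int) \<Rightarrow> nat set set \<Rightarrow> bool" where
  "has_sizes S t Q \<longleftrightarrow> (\<forall>i\<in>S. int (card (block Q i)) = t i)"

lemma B_nonempty: "i \<in> {1..j} \<Longrightarrow> B i \<noteq> {}"
  using partition_onD3[OF part] by (metis imageI)

lemma finite_B: "i \<in> {1..j} \<Longrightarrow> finite (B i)"
proof -
  assume "i \<in> {1..j}"
  then have "B i \<subseteq> \<Union>(B ` {1..j})"
    by blast
  then show "finite (B i)"
    by (metis finite_atLeastAtMost finite_subset partition_onD1[OF part])
qed

lemma extensions_partition: "Q \<in> extensions N \<Longrightarrow> partition_on {1..N} Q"
  by (simp add: extensions_def)

lemma finite_extensions: "finite (extensions N)"
  by (rule finite_subset[OF _ finitely_many_partition_on[of "{1..N}"]]) (auto simp: extensions_def)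

lemma finite_extension: "Q \<in> extensions N \<Longrightarrow> finite Q"
  using finite_elements[OF _ extensions_partition] by blast

lemma extensions_self: "extensions n = {B ` {1..j}}"
  using part by (auto simp: extensions_def restrict_partition_self)

lemma block_eqI:
  assumes "Q \<in> extensions N" "i \<in> {1..j}" "C \<in> Q" "B i \<subseteq> C"
  shows "block Q i = C"
  unfolding block_def
proof (rule the_equality)
  fix D assume D: "D \<in> Q \<and> B i \<subseteq> D"
  then have "D \<inter> C \<noteq> {}"
    using assms(4) B_nonempty[OF assms(2)] by blast
  then show "D = C"
    using D assms(3) partition_onD2[OF extensions_partition[OF assms(1)]] by (auto simp: disjoint_def)
qed (use assms in auto)

text \<open>\<open>B i\<close> is the trace of some block of \<open>Q\<close>, and that block is the
  one containing \<open>B i\<close>.\<close>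

lemma block:
  assumes "Q \<in> extensions N" "i \<in> {1..j}"
  shows "block Q i \<in> Q" "{1..n} \<inter> block Q i = B i"
proof -
  have "B i \<in> restrict_partition n Q"
    using assms by (simp add: extensions_def)
  then obtain C where C: "C \<in> Q" "B i = {1..n} \<inter> C"
    by (auto simp: restrict_partition_def)
  then have "block Q i = C"
    by (intro block_eqI[OF assms]) auto
  with C show "block Q i \<in> Q" "{1..n} \<inter> block Q i = B i"
    by auto
qed

lemma inj_on_block: "Q \<in> extensions N \<Longrightarrow> inj_on (block Q) {1..j}"
  by (rule inj_onI) (metis block(2) inj inj_onD)

lemma finite_extension_block: "Q \<in> extensions N \<Longrightarrow> C \<in> Q \<Longrightarrow> finite C"
proof -
  assume Q: "Q \<in> extensions N" and "C \<in> Q"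
  then have "C \<subseteq> \<Union>Q"
    by blast
  then show "finite C"
    by (metis finite_atLeastAtMost finite_subset partition_onD1[OF extensions_partition[OF Q]])
qed

lemma sum_card_extension:
  assumes "Q \<in> extensions N"
  shows "(\<Sum>C\<in>Q. card C) = N"
proof -
  have P: "partition_on {1..N} Q"
    by (rule extensions_partition[OF assms])
  have "card (\<Union>Q) = (\<Sum>C\<in>Q. card C)"
    using partition_onD2[OF P] finite_extension_block[OF assms]
    by (intro card_Union_disjoint) (auto simp: pairwise_def disjoint_def disjnt_def)
  then show ?thesis
    using partition_onD1[OF P] by (metis card_atLeastAtMost diff_Suc_1)
qed

text \<open>The old blocks are distinct, and no block is empty. The bounds allow the number of
  blocks to be written as \<open>j + k\<close> with \<open>k\<close> in a finite range.\<close>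

lemma extension_card:
  assumes "Q \<in> extensions N"
  shows "j \<le> card Q" "card Q \<le> N"
proof -
  have "card (block Q ` {1..j}) \<le> card Q"
    using block(1)[OF assms] finite_extension[OF assms] by (intro card_mono) auto
  then show "j \<le> card Q"
    using card_image[OF inj_on_block[OF assms]] by simp
  have "1 \<le> card C" if "C \<in> Q" for C
    using that finite_extension_block[OF assms that] partition_onD3[OF extensions_partition[OF assms]]
    by (metis One_nat_def Suc_leI card_gt_0_iff)
  then have "(\<Sum>C\<in>Q. 1) \<le> (\<Sum>C\<in>Q. card C)"
    by (intro sum_mono)
  then show "card Q \<le> N"
    by (simp add: sum_card_extension[OF assms])
qed

text \<open>As \<open>n \<le> N\<close>, the new point does not affect the restriction to
  \<open>{1..n}\<close>, so the sum over all partitions can be used with \<open>F\<close> cut off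
  outside the extensions.\<close>

lemma sum_extensions_Suc:
  fixes F :: "nat set set \<Rightarrow> 'b::comm_monoid_add"
  assumes "n \<le> N"
  shows "(\<Sum>Q'\<in>extensions (Suc N). F Q') =
    (\<Sum>Q\<in>extensions N. \<Sum>C\<in>insert {} Q. F (add_point (Suc N) Q C))"
proof -
  define G where "G Q = (if restrict_partition n Q = B ` {1..j} then F Q else 0)" for Q
  have filter: "(\<Sum>Q\<in>extensions N. H Q) =
      (\<Sum>Q | partition_on {1..N} Q. if restrict_partition n Q = B ` {1..j} then H Q else 0)"
    for N and H :: "nat set set \<Rightarrow> 'b"
    using sum.inter_filter[OF finitely_many_partition_on, of "{1..N}"] by (simp add: extensions_def)
  have "(\<Sum>Q'\<in>extensions (Suc N). F Q') = (\<Sum>Q' | partition_on {1..Suc N} Q'. G Q')"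
    by (simp add: filter G_def)
  also have "\<dots> = (\<Sum>Q | partition_on {1..N} Q. \<Sum>C\<in>insert {} Q. G (add_point (Suc N) Q C))"
    using sum_partition_on_insert[of "{1..N}" "Suc N" G] by (simp add: atLeastAtMostSuc_conv)
  also have "\<dots> = (\<Sum>Q\<in>extensions N. \<Sum>C\<in>insert {} Q. F (add_point (Suc N) Q C))"
    unfolding filter
  proof (rule sum.cong[OF refl])
    fix Q assume "Q \<in> {Q. partition_on {1..N} Q}"
    then have "restrict_partition n (add_point (Suc N) Q C) = restrict_partition n Q"
      if "C \<in> insert {} Q" for C
      using that assms by (intro restrict_partition_add_point) auto
    then have "(\<Sum>C\<in>insert {} Q. G (add_point (Suc N) Q C)) = (\<Sum>C\<in>insert {} Q.
        if restrict_partition n Q = B ` {1..j} then F (add_point (Suc N) Q C) else 0)"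
      by (intro sum.cong) (auto simp: G_def)
    then show "(\<Sum>C\<in>insert {} Q. G (add_point (Suc N) Q C)) =
        (if restrict_partition n Q = B ` {1..j}
         then \<Sum>C\<in>insert {} Q. F (add_point (Suc N) Q C) else 0)"
      by simp
  qed
  finally show ?thesis .
qed

lemma block_add_point:
  assumes "Q \<in> extensions N" "n \<le> N" "C \<in> insert {} Q" "i \<in> {1..j}"
  shows "block (add_point (Suc N) Q C) i = (if C = block Q i then insert (Suc N) C else block Q i)"
proof (rule block_eqI[where N = "Suc N"])
  have "partition_on {1..Suc N} (add_point (Suc N) Q C)"
    using partition_on_add_point[OF extensions_partition[OF assms(1)] _ assms(3), of "Suc N"]
    by (simp add: atLeastAtMostSuc_conv)
  then show "add_point (Suc N) Q C \<in> extensions (Suc N)"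
    using assms restrict_partition_add_point[OF extensions_partition[OF assms(1)] assms(3,2)]
    by (simp add: extensions_def)
qed (use block[OF assms(1,4)] assms(4) in \<open>auto simp: add_point_def\<close>)

text \<open>The three terms stand for the new point being a singleton, joining a block indexed by
  \<open>S\<close>, or joining any other block. In the second case the block had size
  \<open>t i - 1\<close> before, whence the shifted \<open>t\<close>. In the third the factors
  \<open>card C - \<alpha>\<close> add up to a value that depends on \<open>Q\<close> only through
  its number of blocks and the sizes of the blocks in \<open>S\<close>, which the indicator
  fixes.\<close>

lemma sum_add_point:
  fixes \<alpha> :: real
  assumes Q: "Q \<in> extensions N" and N: "n \<le> N" and S: "S \<subseteq> {1..j}"
  defines "F \<equiv> \<lambda>K t Q. of_bool (card Q = K \<and> has_sizes S t Q) * partition_weight \<alpha> Q"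
  shows "(\<Sum>C\<in>insert {} Q. F K t (add_point (Suc N) Q C)) =
    of_bool (Suc (card Q) = K \<and> has_sizes S t Q) * partition_weight \<alpha> Q +
    (\<Sum>i\<in>S. (of_int (t i) - 1 - \<alpha>) * F K (t(i := t i - 1)) Q) +
    (real N - of_int (\<Sum>i\<in>S. t i) - (real K - real (card S)) * \<alpha>) * F K t Q"
proof -
  have P: "partition_on {1..N} Q"
    by (rule extensions_partition[OF Q])
  have fin: "finite Q"
    by (rule finite_extension[OF Q])
  have ne: "{} \<notin> Q"
    by (rule partition_onD3[OF P])
  have new: "Suc N \<notin> \<Union>Q"
    using partition_onD1[OF P] by (metis Suc_n_not_le_n atLeastAtMost_iff)
  note fin_block = finite_extension_block[OF Q]
  have weight: "partition_weight \<alpha> (add_point (Suc N) Q C) =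
      partition_weight \<alpha> Q * (if C = {} then 1 else real (card C) - \<alpha>)" if "C \<in> insert {} Q" for C
    by (rule partition_weight_add_point[OF fin ne new that]) (use that fin_block in auto)
  have card: "card (add_point (Suc N) Q C) = card Q + of_bool (C = {})" if "C \<in> insert {} Q" for C
    by (rule card_add_point[OF fin ne new that])
  have blk: "block Q i \<in> Q" if "i \<in> S" for i
    using block(1)[OF Q] that S by auto
  have inj_blk: "inj_on (block Q) S"
    using inj_on_block[OF Q] S by (rule inj_on_subset)
  have sizes_other: "has_sizes S t (add_point (Suc N) Q C) \<longleftrightarrow> has_sizes S t Q"
    if "C \<in> insert {} Q" "C \<notin> block Q ` S" for C
  proof -
    have "block (add_point (Suc N) Q C) i = block Q i" if "i \<in> S" for i
    proof -
      have "i \<in> {1..j}" "C \<noteq> block Q i"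
        using that S \<open>C \<notin> block Q ` S\<close> by blast+
      then show ?thesis
        using block_add_point[OF Q N \<open>C \<in> insert {} Q\<close>, of i] by simp
    qed
    then show ?thesis
      by (simp add: has_sizes_def)
  qed
  have sizes_old: "has_sizes S t (add_point (Suc N) Q (block Q i)) \<longleftrightarrow> has_sizes S (t(i := t i - 1)) Q"
    if i: "i \<in> S" for i
    unfolding has_sizes_def
  proof (intro ball_cong refl)
    fix i' assume i': "i' \<in> S"
    have "card (insert (Suc N) (block Q i)) = Suc (card (block Q i))"
    proof (rule card_insert_disjoint)
      show "Suc N \<notin> block Q i"
        using new blk[OF i] by (meson UnionI)
    qed (rule fin_block[OF blk[OF i]])
    \<comment> \<open>Distinct indices have distinct old blocks, so only the block of
      \<open>i\<close> grows.\<close>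
    moreover have "block Q i = block Q i' \<longleftrightarrow> i = i'"
      using inj_blk i i' by (auto simp: inj_on_def)
    moreover have "block (add_point (Suc N) Q (block Q i)) i' =
        (if block Q i = block Q i' then insert (Suc N) (block Q i) else block Q i')"
      using blk[OF i] i' S by (intro block_add_point[OF Q N]) auto
    ultimately show "(int (card (block (add_point (Suc N) Q (block Q i)) i')) = t i') =
        (int (card (block Q i')) = (t(i := t i - 1)) i')"
      by auto
  qed
  have "(\<Sum>C\<in>insert {} Q. F K t (add_point (Suc N) Q C)) =
      F K t (add_point (Suc N) Q {}) + (\<Sum>C\<in>block Q ` S. F K t (add_point (Suc N) Q C)) +
      (\<Sum>C\<in>Q - block Q ` S. F K t (add_point (Suc N) Q C))"
    using fin ne sum.subset_diff[of "block Q ` S" Q "\<lambda>C. F K t (add_point (Suc N) Q C)"] blk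
    by (simp add: image_subset_iff)
  also have "F K t (add_point (Suc N) Q {}) =
      of_bool (Suc (card Q) = K \<and> has_sizes S t Q) * partition_weight \<alpha> Q"
  proof -
    have "{} \<notin> block Q ` S"
      using blk ne by (metis imageE)
    then show ?thesis
      using weight[of "{}"] card[of "{}"] sizes_other[of "{}"] by (simp add: F_def)
  qed
  also have "(\<Sum>C\<in>block Q ` S. F K t (add_point (Suc N) Q C)) =
      (\<Sum>i\<in>S. (of_int (t i) - 1 - \<alpha>) * F K (t(i := t i - 1)) Q)"
    unfolding sum.reindex[OF inj_blk] comp_def
  proof (rule sum.cong[OF refl])
    fix i assume i: "i \<in> S"
    have "block Q i \<noteq> {}"
      using blk[OF i] ne by metis
    \<comment> \<open>The weight factor has to equal \<open>t i - 1 - \<alpha>\<close> only where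
      the indicator is nonzero.\<close>
    moreover have "real (card (block Q i)) = of_int (t i) - 1" if "has_sizes S (t(i := t i - 1)) Q"
    proof -
      have "int (card (block Q i)) = t i - 1"
        using that i by (auto simp: has_sizes_def)
      then show ?thesis
        by (metis of_int_1 of_int_diff of_int_of_nat_eq)
    qed
    ultimately show "F K t (add_point (Suc N) Q (block Q i)) =
        (of_int (t i) - 1 - \<alpha>) * F K (t(i := t i - 1)) Q"
      using weight[of "block Q i"] card[of "block Q i"] sizes_old[OF i] blk[OF i] by (simp add: F_def)
  qed
  also have "(\<Sum>C\<in>Q - block Q ` S. F K t (add_point (Suc N) Q C)) =
      (real N - of_int (\<Sum>i\<in>S. t i) - (real K - real (card S)) * \<alpha>) * F K t Q"
  proof -
    have "(\<Sum>C\<in>Q - block Q ` S. F K t (add_point (Suc N) Q C)) =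
        (\<Sum>C\<in>Q - block Q ` S. (real (card C) - \<alpha>) * F K t Q)"
    proof (rule sum.cong[OF refl])
      fix C assume C: "C \<in> Q - block Q ` S"
      then have "C \<noteq> {}"
        using ne by blast
      then show "F K t (add_point (Suc N) Q C) = (real (card C) - \<alpha>) * F K t Q"
        using C weight[of C] card[of C] sizes_other[of C] by (simp add: F_def)
    qed
    also have "\<dots> = (\<Sum>C\<in>Q - block Q ` S. real (card C) - \<alpha>) * F K t Q"
      by (simp add: sum_distrib_right)
    also have "(\<Sum>C\<in>Q - block Q ` S. real (card C) - \<alpha>) =
        (\<Sum>C\<in>Q. real (card C) - \<alpha>) - (\<Sum>C\<in>block Q ` S. real (card C) - \<alpha>)"
      using fin blk by (intro sum_diff) auto
    also have "\<dots> = real N - real (card Q) * \<alpha> - ((\<Sum>i\<in>S. real (card (block Q i))) - real (card S) * \<alpha>)"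
      by (simp add: sum_subtractf sum.reindex[OF inj_blk] card_image[OF inj_blk]
          flip: sum_card_extension[OF Q])
    finally have old: "(\<Sum>C\<in>Q - block Q ` S. F K t (add_point (Suc N) Q C)) =
        (real N - real (card Q) * \<alpha> - ((\<Sum>i\<in>S. real (card (block Q i))) - real (card S) * \<alpha>)) *
        F K t Q" .
    show ?thesis
    \<comment> \<open>The true number of blocks and the true sizes may be replaced by
      \<open>K\<close> and \<open>t\<close>, because \<open>F K t Q\<close> vanishes unless they
      agree.\<close>
    proof (cases "card Q = K \<and> has_sizes S t Q")
      case True
      then have "(\<Sum>i\<in>S. real (card (block Q i))) = (\<Sum>i\<in>S. of_int (t i))"
        by (intro sum.cong refl) (metis has_sizes_def of_int_of_nat_eq)
      then show ?thesis
        using True old by (simp add: algebra_simps)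
    next
      case False
      then have "F K t Q = 0"
        by (simp add: F_def)
      then show ?thesis
        using old by simp
    qed
  qed
  finally show ?thesis .
qed

text \<open>The number of blocks is fixed along with the sizes because \<open>V\<close> depends on
  it; with \<open>V\<close> itself left out, the recursion is purely combinatorial.\<close>

definition extension_count :: "real \<Rightarrow> nat set \<Rightarrow> nat \<Rightarrow> nat \<Rightarrow> (nat \<Rightarrow> int) \<Rightarrow> real" where
  "extension_count \<alpha> S N K t =
     (\<Sum>Q\<in>extensions N. of_bool (card Q = K \<and> has_sizes S t Q) * partition_weight \<alpha> Q)"

lemma extension_count_Suc:
  assumes N: "n \<le> N" and S: "S \<subseteq> {1..j}"
  shows "extension_count \<alpha> S (Suc N) (j + k) t =
    (if k = 0 then 0 else extension_count \<alpha> S N (j + (k - 1)) t) +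
    (\<Sum>i\<in>S. (of_int (t i) - 1 - \<alpha>) * extension_count \<alpha> S N (j + k) (t(i := t i - 1))) +
    (real N - of_int (\<Sum>i\<in>S. t i) - (real (j + k) - real (card S)) * \<alpha>) *
      extension_count \<alpha> S N (j + k) t"
proof -
  have "(\<Sum>Q\<in>extensions N. of_bool (Suc (card Q) = j + k \<and> has_sizes S t Q) * partition_weight \<alpha> Q) =
      (if k = 0 then 0 else extension_count \<alpha> S N (j + (k - 1)) t)"
  \<comment> \<open>For \<open>k = 0\<close> the smaller extension would have fewer than
    \<open>j\<close> blocks.\<close>
  proof (cases k)
    case 0
    then have "Suc (card Q) \<noteq> j + k" if "Q \<in> extensions N" for Q
      using extension_card(1)[OF that] by simp
    then show ?thesis
      using 0 by simp
  qed (simp add: extension_count_def)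
  moreover have "extension_count \<alpha> S (Suc N) (j + k) t = (\<Sum>Q\<in>extensions N.
      of_bool (Suc (card Q) = j + k \<and> has_sizes S t Q) * partition_weight \<alpha> Q +
      (\<Sum>i\<in>S. (of_int (t i) - 1 - \<alpha>) *
        (of_bool (card Q = j + k \<and> has_sizes S (t(i := t i - 1)) Q) * partition_weight \<alpha> Q)) +
      (real N - of_int (\<Sum>i\<in>S. t i) - (real (j + k) - real (card S)) * \<alpha>) *
        (of_bool (card Q = j + k \<and> has_sizes S t Q) * partition_weight \<alpha> Q))"
    unfolding extension_count_def sum_extensions_Suc[OF N]
    by (intro sum.cong refl sum_add_point N S)
  ultimately show ?thesis
    unfolding sum.distrib extension_count_def sum_distrib_left
    by (simp only: sum.swap[of _ S "extensions N"])
qed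

text \<open>The factor \<open>fact m\<close> and the factorials inside the coefficients count the
  ways to split the \<open>m\<close> points into the gains of the blocks in \<open>S\<close> and a
  rest. The Stirling number weighs the arrangements of the rest into \<open>k\<close> new blocks and
  the old blocks outside \<open>S\<close>, whose initial total weight is -\<gamma>. The induction
  generalises \<open>k\<close> and \<open>t\<close>, since the recursion changes both.\<close>

lemma extension_count_eq:
  fixes \<alpha> :: real
  assumes S: "S \<subseteq> {1..j}"
  defines "\<gamma> \<equiv> - (real n - (real j - real (card S)) * \<alpha> - (\<Sum>i\<in>S. real (card (B i))))"
  shows "extension_count \<alpha> S (n + m) (j + k) t =
    partition_weight \<alpha> (B ` {1..j}) * fact m *
    (\<Prod>i\<in>S. gain_coeff (real (card (B i)) - \<alpha>) (t i - int (card (B i)))) *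
    rest_coeff \<alpha> \<gamma> (int m - (\<Sum>i\<in>S. t i - int (card (B i)))) k"
proof (induction m arbitrary: k t)
  case 0
  have self: "B ` {1..j} \<in> extensions n"
    by (simp add: extensions_self)
  have "block (B ` {1..j}) i = B i" if "i \<in> S" for i
    using that S by (intro block_eqI[OF self]) auto
  then have sizes: "has_sizes S t (B ` {1..j}) \<longleftrightarrow> (\<forall>i\<in>S. int (card (B i)) = t i)"
    by (simp add: has_sizes_def)
  have card: "card (B ` {1..j}) = j"
    using card_image[OF inj] by simp
  have finS: "finite S"
    using S finite_subset by blast
  have count: "extension_count \<alpha> S n (j + k) t =
      of_bool (k = 0 \<and> (\<forall>i\<in>S. int (card (B i)) = t i)) * partition_weight \<alpha> (B ` {1..j})"
    by (simp add: extension_count_def extensions_self sizes card del: One_nat_def)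
  show ?case
  proof (cases "\<forall>i\<in>S. int (card (B i)) = t i")
    case True
    then show ?thesis
      by (simp add: count gain_coeff_def rest_coeff_def noncentral_stirling_0 del: One_nat_def)
  next
    case False
    \<comment> \<open>A prescribed size below \<open>card (B i)\<close> makes a gain coefficient
      vanish. If there is none, the total gain is positive although no point has been added, and
      \<open>rest_coeff\<close> has a negative argument.\<close>
    have "(\<Prod>i\<in>S. gain_coeff (real (card (B i)) - \<alpha>) (t i - int (card (B i)))) = 0 \<or>
        (\<Sum>i\<in>S. t i - int (card (B i))) > 0"
    proof (cases "\<forall>i\<in>S. t i \<ge> int (card (B i))")
      case True
      then obtain i where "i \<in> S" "t i > int (card (B i))"
        using False by force
      then have "(\<Sum>i\<in>S. t i - int (card (B i))) > 0"
        using finS True by (intro sum_pos2[of S i]) auto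
      then show ?thesis ..
    next
      case False
      then obtain i where "i \<in> S" "t i < int (card (B i))"
        by force
      then have "(\<Prod>i\<in>S. gain_coeff (real (card (B i)) - \<alpha>) (t i - int (card (B i)))) = 0"
        using finS by (intro prod_zero) (auto simp: gain_coeff_def)
      then show ?thesis ..
    qed
    then show ?thesis
      using False by (auto simp: count rest_coeff_def)
  qed
next
  case (Suc m)
  define w where "w = partition_weight \<alpha> (B ` {1..j})"
  define a where "a i z = gain_coeff (real (card (B i)) - \<alpha>) (z - int (card (B i)))" for i z
  define P where "P = (\<Prod>i\<in>S. a i (t i))"
  define g where "g = (\<Sum>i\<in>S. t i - int (card (B i)))"
  define z where "z = int m - g"
  define b where "b = rest_coeff \<alpha> \<gamma>"
  have finS: "finite S"
    using S finite_subset by blast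
  have IH: "extension_count \<alpha> S (n + m) (j + k) t = w * fact m * P * b z k" for k
    using Suc.IH[of k t] by (simp add: w_def P_def a_def z_def g_def b_def)
  \<comment> \<open>Lowering \<open>t i\<close> by one raises the argument of
    \<open>rest_coeff\<close> by one, and \<open>gain_coeff_rec\<close> turns the joining factor
    into the gain of block \<open>i\<close>.\<close>
  have IH_upd: "(of_int (t i) - 1 - \<alpha>) * extension_count \<alpha> S (n + m) (j + k) (t(i := t i - 1)) =
      w * fact m * P * b (z + 1) k * of_int (t i - int (card (B i)))" if i: "i \<in> S" for i
  proof -
    have "(\<Prod>i'\<in>S. a i' ((t(i := t i - 1)) i')) = a i (t i - 1) * (\<Prod>i'\<in>S - {i}. a i' (t i'))"
    proof -
      have "(\<Prod>i'\<in>S - {i}. a i' ((t(i := t i - 1)) i')) = (\<Prod>i'\<in>S - {i}. a i' (t i'))"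
        by (rule prod.cong) auto
      then show ?thesis
        by (simp only: prod.remove[OF finS i, of "\<lambda>i'. a i' ((t(i := t i - 1)) i')"] fun_upd_same)
    qed
    moreover have "P = a i (t i) * (\<Prod>i'\<in>S - {i}. a i' (t i'))"
      using prod.remove[OF finS i] by (simp add: P_def)
    moreover have "(of_int (t i) - 1 - \<alpha>) * a i (t i - 1) = of_int (t i - int (card (B i))) * a i (t i)"
      using gain_coeff_rec[of "real (card (B i)) - \<alpha>" "t i - int (card (B i))"]
      by (simp add: a_def algebra_simps)
    ultimately have "(of_int (t i) - 1 - \<alpha>) * (\<Prod>i'\<in>S. a i' ((t(i := t i - 1)) i')) =
        of_int (t i - int (card (B i))) * P"
      by simp
    moreover have "(\<Sum>i'\<in>S. (t(i := t i - 1)) i' - int (card (B i'))) = g - 1"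
    proof -
      have "(\<Sum>i'\<in>S - {i}. (t(i := t i - 1)) i' - int (card (B i'))) =
          (\<Sum>i'\<in>S - {i}. t i' - int (card (B i')))"
        by (rule sum.cong) auto
      then show ?thesis
        using sum.remove[OF finS i, of "\<lambda>i'. (t(i := t i - 1)) i' - int (card (B i'))"]
          sum.remove[OF finS i, of "\<lambda>i'. t i' - int (card (B i'))"]
        by (simp add: g_def)
    qed
    moreover have "extension_count \<alpha> S (n + m) (j + k) (t(i := t i - 1)) =
        w * fact m * (\<Prod>i'\<in>S. a i' ((t(i := t i - 1)) i')) *
        b (int m - (\<Sum>i'\<in>S. (t(i := t i - 1)) i' - int (card (B i')))) k"
      using Suc.IH[of k "t(i := t i - 1)"] by (simp only: w_def a_def b_def)
    moreover have "int m - (g - 1) = z + 1"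
      by (simp add: z_def)
    ultimately show ?thesis
      by (simp add: mult_ac)
  qed
  \<comment> \<open>The value of \<gamma> is made for this identity: the factor for joining a block
    outside \<open>S\<close> becomes the one in \<open>rest_coeff_rec\<close>.\<close>
  have "real (n + m) - of_int (\<Sum>i\<in>S. t i) - (real (j + k) - real (card S)) * \<alpha>
      = of_int z - \<gamma> - real k * \<alpha>"
    by (simp add: z_def g_def \<gamma>_def sum_subtractf algebra_simps)
  then have "extension_count \<alpha> S (Suc (n + m)) (j + k) t =
      (if k = 0 then 0 else w * fact m * P * b z (k - 1)) +
      (\<Sum>i\<in>S. w * fact m * P * b (z + 1) k * of_int (t i - int (card (B i)))) +
      (of_int z - \<gamma> - real k * \<alpha>) * (w * fact m * P * b z k)"
    using extension_count_Suc[of "n + m" S \<alpha> k t, OF _ S] by (simp only: IH IH_upd le_add1 cong: sum.cong)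
  also have "(\<Sum>i\<in>S. w * fact m * P * b (z + 1) k * of_int (t i - int (card (B i)))) =
      w * fact m * P * b (z + 1) k * of_int g"
    by (simp only: g_def of_int_sum sum_distrib_left)
  also have "(if k = 0 then 0 else w * fact m * P * b z (k - 1)) +
      w * fact m * P * b (z + 1) k * of_int g + (of_int z - \<gamma> - real k * \<alpha>) * (w * fact m * P * b z k) =
      w * fact m * P * ((of_int z - \<gamma> - real k * \<alpha>) * b z k + (if k = 0 then 0 else b z (k - 1)) +
        of_int g * b (z + 1) k)"
    by (simp add: algebra_simps)
  \<comment> \<open>\<open>rest_coeff_rec\<close> yields \<open>z + 1\<close> and the blocks in
    \<open>S\<close> yield \<open>g\<close>; since \<open>z = m - g\<close>, they add up to
    \<open>m + 1\<close> and complete \<open>fact (Suc m)\<close>.\<close>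
  also have "\<dots> = w * fact m * P * (of_int (z + 1) * b (z + 1) k + of_int g * b (z + 1) k)"
    by (simp only: b_def rest_coeff_rec)
  also have "\<dots> = w * fact (Suc m) * P * b (int (Suc m) - g) k"
    by (simp add: z_def algebra_simps)
  finally show ?case
    by (simp add: w_def P_def a_def g_def b_def)
qed

end

section \<open>Falling factorial moments\<close>

lemma finite_admissible: "finite (admissible j B l r)"
  by (rule finite_subset[of _ "Pow {1..j}"]) (auto simp: admissible_def)

lemma falling_fact_eq_binomial: "falling_fact (real c) r = fact r * real (c choose r)"
  by (simp add: falling_fact_def binomial_gbinomial gbinomial_prod_rev atLeast0LessThan)

context initial_blocks
begin

text \<open>Grouping by the number of blocks: by \<open>extension_card\<close> each extension is met
  for exactly one \<open>k\<close> in the range.\<close>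

lemma sum_extensions_has_sizes:
  "(\<Sum>Q\<in>extensions (n + m). of_bool (has_sizes S t Q) * (W (card Q) * partition_weight \<alpha> Q)) =
    (\<Sum>k=0..n+m. W (j + k) * extension_count \<alpha> S (n + m) (j + k) t)"
proof -
  have "(\<Sum>k=0..n+m. W (j + k) * extension_count \<alpha> S (n + m) (j + k) t) =
      (\<Sum>Q\<in>extensions (n + m). \<Sum>k=0..n+m.
        W (j + k) * (of_bool (card Q = j + k \<and> has_sizes S t Q) * partition_weight \<alpha> Q))"
    unfolding extension_count_def sum_distrib_left by (rule sum.swap)
  also have "\<dots> =
      (\<Sum>Q\<in>extensions (n + m). of_bool (has_sizes S t Q) * (W (card Q) * partition_weight \<alpha> Q))"
  proof (rule sum.cong[OF refl])
    fix Q assume "Q \<in> extensions (n + m)"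
    then have "j \<le> card Q" "card Q - j \<le> n + m"
      using extension_card[of Q "n + m"] by auto
    then have "(\<Sum>k=0..n+m. W (j + k) *
        (of_bool (card Q = j + k \<and> has_sizes S t Q) * partition_weight \<alpha> Q)) =
        (\<Sum>k=0..n+m. if k = card Q - j
          then of_bool (has_sizes S t Q) * (W (card Q) * partition_weight \<alpha> Q) else 0)"
      by (intro sum.cong) auto
    also have "\<dots> = of_bool (has_sizes S t Q) * (W (card Q) * partition_weight \<alpha> Q)"
      using \<open>card Q - j \<le> n + m\<close> by simp
    finally show "(\<Sum>k=0..n+m. W (j + k) *
        (of_bool (card Q = j + k \<and> has_sizes S t Q) * partition_weight \<alpha> Q)) =
        of_bool (has_sizes S t Q) * (W (card Q) * partition_weight \<alpha> Q)" .
  qed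
  finally show ?thesis ..
qed

lemma card_B_le:
  assumes "Q \<in> extensions N" "i \<in> {1..j}"
  shows "card (B i) \<le> card (block Q i)"
  using block[OF assms] finite_extension_block[OF assms(1)] by (metis card_mono inf_le2)

text \<open>The trace of an old block on \<open>{1..n}\<close> is \<open>B i\<close>, so its size is
  \<open>card (B i)\<close> plus the number of points gained.\<close>

lemma num_old_blocks_extension:
  assumes "Q \<in> extensions (n + m)"
  shows "num_old_blocks n m j B l Q = card {i \<in> {1..j}. card (block Q i) = l}"
proof -
  have P: "partition_on {1..n+m} Q"
    by (rule extensions_partition[OF assms])
  have size: "card (B i) + old_gain n m B Q i = card (block Q i)" if "i \<in> {1..j}" for i
  proof -
    have "old_block n m B Q i = block Q i"
      by (simp add: old_block_def block_def restrict_partition_self[OF P])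
    moreover have "block Q i \<subseteq> {1..n+m}"
      using block(1)[OF assms that] unfolding partition_onD1[OF P] by (rule Union_upper)
    then have "block Q i = B i \<union> (block Q i \<inter> {n+1..n+m})"
      unfolding block(2)[OF assms that, symmetric] by (auto simp: subset_iff)
    moreover have "B i \<inter> (block Q i \<inter> {n+1..n+m}) = {}"
      unfolding block(2)[OF assms that, symmetric] by auto
    moreover note finite_B[OF that]
    ultimately show ?thesis
      by (metis card_Un_disjoint finite_Int finite_atLeastAtMost old_gain_def)
  qed
  have "num_old_blocks n m j B l Q = (\<Sum>i\<in>{i\<in>{1..j}. card (B i) \<le> l}. of_bool (card (block Q i) = l))"
    unfolding num_old_blocks_def by (intro sum.cong) (auto simp: size)
  also have "\<dots> = card ({i\<in>{1..j}. card (B i) \<le> l} \<inter> {i. card (block Q i) = l})"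
    by simp
  also have "{i\<in>{1..j}. card (B i) \<le> l} \<inter> {i. card (block Q i) = l} = {i \<in> {1..j}. card (block Q i) = l}"
    using card_B_le[OF assms] by auto
  finally show ?thesis .
qed

lemma falling_fact_num_old_blocks:
  assumes "Q \<in> extensions (n + m)"
  shows "falling_fact (real (num_old_blocks n m j B l Q)) r =
    fact r * (\<Sum>\<Xi>\<in>admissible j B l r. of_bool (has_sizes \<Xi> (\<lambda>_. int l) Q))"
proof -
  define A where "A = {i \<in> {1..j}. card (block Q i) = l}"
  \<comment> \<open>A subset of \<open>A\<close> is admissible, since an initial block is never
    larger than the old block containing it.\<close>
  have "admissible j B l r \<inter> {\<Xi>. has_sizes \<Xi> (\<lambda>_. int l) Q} = {\<Xi>. \<Xi> \<subseteq> A \<and> card \<Xi> = r}"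
    using card_B_le[OF assms] unfolding admissible_def has_sizes_def A_def by auto
  then have "(\<Sum>\<Xi>\<in>admissible j B l r. of_bool (has_sizes \<Xi> (\<lambda>_. int l) Q)) =
      real (card {\<Xi>. \<Xi> \<subseteq> A \<and> card \<Xi> = r})"
    using finite_admissible by simp
  also have "\<dots> = real (card A choose r)"
    by (simp add: A_def n_subsets)
  finally show ?thesis
    by (simp add: falling_fact_eq_binomial num_old_blocks_extension[OF assms] A_def)
qed

text \<open>Expanding the product of sums gives one term for each family of index sets. If two of
  the sets share an index, their size conditions contradict each other, so only disjoint families
  survive.\<close>

lemma prod_falling_fact_num_old_blocks:
  assumes "Q \<in> extensions (n + m)"
  shows "(\<Prod>l=1..L. falling_fact (real (num_old_blocks n m j B l Q)) (r l)) =
    (\<Prod>l=1..L. fact (r l)) *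
    (\<Sum>\<Xi>\<in>admissible_families L j B r. of_bool (\<forall>l\<in>{1..L}. has_sizes (\<Xi> l) (\<lambda>_. int l) Q))"
proof -
  let ?F = "\<Pi>\<^sub>E l\<in>{1..L}. admissible j B l (r l)"
  have "(\<Prod>l=1..L. \<Sum>\<Xi>\<in>admissible j B l (r l). of_bool (has_sizes \<Xi> (\<lambda>_. int l) Q)) =
      (\<Sum>\<Xi>\<in>?F. \<Prod>l=1..L. of_bool (has_sizes (\<Xi> l) (\<lambda>_. int l) Q) :: real)"
    by (rule prod_sum_PiE) (auto intro: finite_admissible)
  also have "\<dots> = (\<Sum>\<Xi>\<in>?F. of_bool (\<forall>l\<in>{1..L}. has_sizes (\<Xi> l) (\<lambda>_. int l) Q))"
    by (intro sum.cong refl) (auto simp: of_bool_def intro!: prod_zero)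
  also have "\<dots> = (\<Sum>\<Xi>\<in>admissible_families L j B r.
      of_bool (\<forall>l\<in>{1..L}. has_sizes (\<Xi> l) (\<lambda>_. int l) Q))"
  proof (rule sum.mono_neutral_right)
    show "finite ?F"
      by (intro finite_PiE finite_admissible) auto
    show "\<forall>\<Xi>\<in>?F - admissible_families L j B r.
        of_bool (\<forall>l\<in>{1..L}. has_sizes (\<Xi> l) (\<lambda>_. int l) Q) = (0 :: real)"
    proof
      fix \<Xi> assume "\<Xi> \<in> ?F - admissible_families L j B r"
      then have "\<not> disjoint_family_on \<Xi> {1..L}"
        by (simp add: admissible_families_def)
      then obtain l l' i where "l \<in> {1..L}" "l' \<in> {1..L}" "l \<noteq> l'" "i \<in> \<Xi> l" "i \<in> \<Xi> l'"
        unfolding disjoint_family_on_def by blast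
      then have "\<not> (\<forall>l\<in>{1..L}. has_sizes (\<Xi> l) (\<lambda>_. int l) Q)"
        unfolding has_sizes_def by (metis of_nat_eq_iff)
      then show "of_bool (\<forall>l\<in>{1..L}. has_sizes (\<Xi> l) (\<lambda>_. int l) Q) = (0 :: real)"
        by simp
    qed
  qed (auto simp: admissible_families_def)
  finally show ?thesis
    by (simp add: falling_fact_num_old_blocks[OF assms] prod.distrib del: One_nat_def)
qed

end

text \<open>Old blocks are read off the restriction to \<open>{1..n+m}\<close>, so the moments are
  finite sums over its possible values.\<close>

lemma num_old_blocks_restrict:
  "num_old_blocks n m j B l (restrict_partition (n + m) P) = num_old_blocks n m j B l P"
  by (simp add: num_old_blocks_def old_gain_def old_block_def restrict_partition_restrict)

section \<open>The conditional law of the restriction to \<open>{1..n+m}\<close>\<close>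

locale conditional_gibbs_partition = gibbs_partition M X \<alpha> V + initial_blocks n j B
  for M :: "'a measure" and X \<alpha> V n j B +
  assumes n_pos: "1 \<le> n" and V_pos: "V n j > 0"
begin

text \<open>For an extension \<open>Q\<close> this is a quotient of two Gibbs probabilities; the
  denominator belongs to the conditioning event.\<close>

definition extension_prob :: "nat \<Rightarrow> nat set set \<Rightarrow> real" where
  "extension_prob N Q =
     V N (card Q) * partition_weight \<alpha> Q / (V n j * partition_weight \<alpha> (B ` {1..j}))"

lemma partition_weight_pos: "partition_weight \<alpha> Q > 0"
  using alpha_less_1 unfolding partition_weight_def by (intro prod_pos) (simp add: pochhammer_pos)

text \<open>The restriction takes finitely many values. The event of a value \<open>Q\<close> lies
  inside the conditioning event if \<open>Q\<close> is an extension and is disjoint from it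
  otherwise.\<close>

lemma integral_conditional_law:
  fixes h :: "nat set set \<Rightarrow> real"
  shows "(\<integral>\<omega>. h (restrict_partition (n + m) (X \<omega>)) \<partial>conditional_law M X n (B ` {1..j})) =
    (\<Sum>Q\<in>extensions (n + m). h Q * extension_prob (n + m) Q)"
proof -
  define ev where "ev N Q = {\<omega>\<in>space M. restrict_partition N (X \<omega>) = Q}" for N Q
  define E where "E = ev n (B ` {1..j})"
  define R where "R = {Q. partition_on {1..n+m} Q}"
  define K where "K = uniform_measure M E"
  have cardB: "card (B ` {1..j}) = j"
    using card_image[OF inj] by simp
  have sets_ev: "ev N Q \<in> sets M" if "partition_on {1..N} Q" for N Q
    unfolding ev_def by (rule measurable_restrict[OF that])
  have prob_ev: "prob (ev N Q) = V N (card Q) * partition_weight \<alpha> Q"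
    if "partition_on {1..N} Q" "1 \<le> N" for N Q
    unfolding ev_def partition_weight_def by (rule prob_restrict[OF that(2,1)])
  have probE: "prob E = V n j * partition_weight \<alpha> (B ` {1..j})"
    unfolding E_def using prob_ev[OF part n_pos] cardB by simp
  then have probE_pos: "prob E > 0"
    using V_pos partition_weight_pos by simp
  then have E: "emeasure M E \<noteq> 0" "emeasure M E \<noteq> \<infinity>"
    by (auto simp: emeasure_eq_measure)
  interpret K: prob_space K
    unfolding K_def by (rule prob_space_uniform_measure) (use E in auto)
  have finR: "finite R"
    unfolding R_def by (rule finitely_many_partition_on) simp
  have prob_K: "measure K (ev (n + m) Q) = (if Q \<in> extensions (n + m) then extension_prob (n + m) Q else 0)"
    if "Q \<in> R" for Q
  proof -
    have Q: "partition_on {1..n+m} Q"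
      using that by (simp add: R_def)
    have "restrict_partition n (X \<omega>) = restrict_partition n Q" if "\<omega> \<in> ev (n + m) Q" for \<omega>
      using that restrict_partition_restrict[of n "n + m" "X \<omega>"] by (simp add: ev_def)
    then have "E \<inter> ev (n + m) Q = (if Q \<in> extensions (n + m) then ev (n + m) Q else {})"
      using Q by (auto simp: E_def extensions_def ev_def)
    moreover have "measure K (ev (n + m) Q) = prob (E \<inter> ev (n + m) Q) / prob E"
      unfolding K_def by (rule measure_uniform_measure[OF E sets_ev[OF Q]])
    ultimately show ?thesis
      using prob_ev[OF Q] n_pos by (simp add: probE extension_prob_def)
  qed
  \<comment> \<open>Measurability is assumed only for the events \<open>ev N Q\<close>, so the
    integrand is expanded in their indicators.\<close>
  have "(\<integral>\<omega>. h (restrict_partition (n + m) (X \<omega>)) \<partial>K) =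
      (\<integral>\<omega>. (\<Sum>Q\<in>R. h Q * indicator (ev (n + m) Q) \<omega>) \<partial>K)"
  proof (rule Bochner_Integration.integral_cong[OF refl])
    fix \<omega> assume "\<omega> \<in> space K"
    then have \<omega>: "\<omega> \<in> space M"
      by (simp add: K_def)
    then have "restrict_partition (n + m) (X \<omega>) \<in> R"
      unfolding R_def using partition_on_restrict_partition[OF partition[OF \<omega>], of "n + m"] by auto
    moreover have "(\<Sum>Q\<in>R. h Q * indicator (ev (n + m) Q) \<omega>) =
        (\<Sum>Q\<in>R. if Q = restrict_partition (n + m) (X \<omega>) then h Q else 0)"
      using \<omega> by (intro sum.cong) (auto simp: ev_def)
    ultimately show "h (restrict_partition (n + m) (X \<omega>)) = (\<Sum>Q\<in>R. h Q * indicator (ev (n + m) Q) \<omega>)"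
      using finR by simp
  qed
  also have "\<dots> = (\<Sum>Q\<in>R. h Q * measure K (ev (n + m) Q))"
  proof -
    have "ev (n + m) Q \<in> sets K" if "Q \<in> R" for Q
      using that sets_ev by (simp add: K_def R_def)
    then show ?thesis
      by (subst Bochner_Integration.integral_sum)
        (auto intro!: sum.cong integrable_mult_right simp: K.emeasure_eq_measure)
  qed
  also have "\<dots> = (\<Sum>Q\<in>extensions (n + m). h Q * extension_prob (n + m) Q)"
    using finR by (intro sum.mono_neutral_cong_right) (auto simp: prob_K R_def extensions_def)
  finally show ?thesis
    by (simp add: K_def E_def ev_def conditional_law_def)
qed

text \<open>The left side is the conditional probability that the old blocks in \<open>S\<close>
  have sizes \<open>t\<close>. The value comes from \<open>extension_count_eq\<close>, whose factor
  \<open>w\<close> cancels against the denominator of \<open>extension_prob\<close>.\<close>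

lemma sum_has_sizes_extension_prob:
  fixes m :: nat and t :: "nat \<Rightarrow> nat"
  assumes S: "S \<subseteq> {1..j}" and t: "\<forall>i\<in>S. card (B i) \<le> t i"
  defines "z \<equiv> int m - (\<Sum>i\<in>S. int (t i)) + (\<Sum>i\<in>S. int (card (B i)))"
  shows "(\<Sum>Q\<in>extensions (n + m). of_bool (has_sizes S (\<lambda>i. int (t i)) Q) * extension_prob (n + m) Q) =
    (if z < 0 then 0 else
      fact m * (\<Prod>i\<in>S. pochhammer (real (card (B i)) - \<alpha>) (t i - card (B i)))
      / ((\<Prod>i\<in>S. fact (t i - card (B i))) * fact (nat z))
      * (\<Sum>k=0..nat z. V (n + m) (j + k) / V n j *
           noncentral_stirling \<alpha>
             (- (real n - (real j - real (card S)) * \<alpha> - (\<Sum>i\<in>S. real (card (B i))))) (nat z) k))"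
proof -
  define \<gamma> where "\<gamma> = - (real n - (real j - real (card S)) * \<alpha> - (\<Sum>i\<in>S. real (card (B i))))"
  define w where "w = partition_weight \<alpha> (B ` {1..j})"
  have w: "w \<noteq> 0"
    using partition_weight_pos[of "B ` {1..j}"] by (simp add: w_def)
  define P where "P = (\<Prod>i\<in>S. pochhammer (real (card (B i)) - \<alpha>) (t i - card (B i))) /
    (\<Prod>i\<in>S. fact (t i - card (B i)))"
  have z: "int m - (\<Sum>i\<in>S. int (t i) - int (card (B i))) = z"
    by (simp add: z_def sum_subtractf)
  have P: "(\<Prod>i\<in>S. gain_coeff (real (card (B i)) - \<alpha>) (int (t i) - int (card (B i)))) = P"
    unfolding P_def prod_dividef[symmetric]
    by (rule prod.cong) (use t in \<open>auto simp: gain_coeff_def simp flip: of_nat_diff\<close>)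
  have count: "extension_count \<alpha> S (n + m) (j + k) (\<lambda>i. int (t i)) = w * fact m * P * rest_coeff \<alpha> \<gamma> z k" for k
    unfolding extension_count_eq[OF S] w_def \<gamma>_def P z ..
  have "(\<Sum>Q\<in>extensions (n + m). of_bool (has_sizes S (\<lambda>i. int (t i)) Q) * extension_prob (n + m) Q) =
      (\<Sum>Q\<in>extensions (n + m). of_bool (has_sizes S (\<lambda>i. int (t i)) Q) *
        (V (n + m) (card Q) * partition_weight \<alpha> Q)) / (V n j * w)"
    by (simp only: extension_prob_def w_def sum_divide_distrib times_divide_eq_right)
  also have "\<dots> = (\<Sum>k=0..n+m. V (n + m) (j + k) * (w * fact m * P * rest_coeff \<alpha> \<gamma> z k)) / (V n j * w)"
    unfolding sum_extensions_has_sizes count ..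
  also have "\<dots> = (\<Sum>k=0..n+m. fact m * P * (V (n + m) (j + k) / V n j * rest_coeff \<alpha> \<gamma> z k))"
    unfolding sum_divide_distrib using w by (intro sum.cong) (auto simp: field_simps)
  also have "\<dots> = fact m * P * (\<Sum>k=0..n+m. V (n + m) (j + k) / V n j * rest_coeff \<alpha> \<gamma> z k)"
    by (simp only: sum_distrib_left)
  finally have main: "(\<Sum>Q\<in>extensions (n + m).
      of_bool (has_sizes S (\<lambda>i. int (t i)) Q) * extension_prob (n + m) Q) =
      fact m * P * (\<Sum>k=0..n+m. V (n + m) (j + k) / V n j * rest_coeff \<alpha> \<gamma> z k)" .
  show ?thesis
  proof (cases "z < 0")
    case True
    then show ?thesis
      by (simp add: main rest_coeff_def)
  next
    case False
    \<comment> \<open>Gains are nonnegative, so \<open>nat z\<close> is within the summation range,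
      and the terms beyond it vanish with the Stirling numbers.\<close>
    have "(\<Sum>i\<in>S. int (card (B i))) \<le> (\<Sum>i\<in>S. int (t i))"
      using t by (intro sum_mono) auto
    then have "nat z \<le> n + m"
      by (simp add: z_def)
    then have "(\<Sum>k=0..n+m. V (n + m) (j + k) / V n j * rest_coeff \<alpha> \<gamma> z k) =
        (\<Sum>k=0..nat z. V (n + m) (j + k) / V n j * rest_coeff \<alpha> \<gamma> z k)"
      by (intro sum.mono_neutral_right) (auto simp: rest_coeff_def noncentral_stirling_eq_0)
    also have "\<dots> = (\<Sum>k=0..nat z. V (n + m) (j + k) / V n j * noncentral_stirling \<alpha> \<gamma> (nat z) k) / fact (nat z)"
      using False by (simp add: rest_coeff_def sum_divide_distrib)
    finally show ?thesis
      using False by (simp add: main P_def \<gamma>_def)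
  qed
qed

end

section \<open>Joint and single moments from the size probabilities\<close>

theorem proposition10:
  fixes M :: "'a measure" and X :: "'a \<Rightarrow> nat set set"
    and \<alpha> :: real and V :: "nat \<Rightarrow> nat \<Rightarrow> real"
    and n m j :: nat and B :: "nat \<Rightarrow> nat set"
  assumes gibbs: "gibbs_partition M X \<alpha> V"
    and n: "n \<ge> 1" and m: "m \<ge> 1"
    and part: "partition_on {1..n} (B ` {1..j})" and inj: "inj_on B {1..j}"
    and V_pos: "V n j > 0"
  shows
    "(\<forall>r :: nat \<Rightarrow> nat.
       (\<integral>\<omega>. (\<Prod>l=1..n+m. falling_fact (real (num_old_blocks n m j B l (X \<omega>))) (r l))
          \<partial>conditional_law M X n (B ` {1..j})) =
       (\<Prod>l=1..n+m. fact (r l)) *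
       (\<Sum>\<Xi>\<in>admissible_families (n + m) j B r.
          let N = int m - (\<Sum>l=1..n+m. int l * int (r l)) + (\<Sum>l=1..n+m. \<Sum>\<xi>\<in>\<Xi> l. int (card (B \<xi>)))
          in if N < 0 then 0 else
            fact m * (\<Prod>l=1..n+m. \<Prod>\<xi>\<in>\<Xi> l. pochhammer (real (card (B \<xi>)) - \<alpha>) (l - card (B \<xi>)))
            / ((\<Prod>l=1..n+m. \<Prod>\<xi>\<in>\<Xi> l. fact (l - card (B \<xi>))) * fact (nat N))
            * (\<Sum>k=0..nat N. V (n + m) (j + k) / V n j *
                 noncentral_stirling \<alpha>
                   (- (real n - (real j - (\<Sum>l=1..n+m. real (r l))) * \<alpha>
                       - (\<Sum>l=1..n+m. \<Sum>\<xi>\<in>\<Xi> l. real (card (B \<xi>)))))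
                   (nat N) k)))
     \<and>
     (\<forall>l\<in>{1..n+m}. \<forall>r :: nat.
       (\<integral>\<omega>. falling_fact (real (num_old_blocks n m j B l (X \<omega>))) r
          \<partial>conditional_law M X n (B ` {1..j})) =
       fact r *
       (\<Sum>\<Xi>\<in>admissible j B l r.
          let N = int m - int r * int l + (\<Sum>\<xi>\<in>\<Xi>. int (card (B \<xi>)))
          in if N < 0 then 0 else
            fact m * (\<Prod>\<xi>\<in>\<Xi>. pochhammer (real (card (B \<xi>)) - \<alpha>) (l - card (B \<xi>)))
            / ((\<Prod>\<xi>\<in>\<Xi>. fact (l - card (B \<xi>))) * fact (nat N))
            * (\<Sum>k=0..nat N. V (n + m) (j + k) / V n j *
                 noncentral_stirling \<alpha>
                   (- (real n - (real j - real r) * \<alpha> - (\<Sum>\<xi>\<in>\<Xi>. real (card (B \<xi>)))))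
                   (nat N) k)))"
proof -
  interpret gibbs_partition M X \<alpha> V
    by (rule gibbs)
  interpret conditional_gibbs_partition M X \<alpha> V n j B
    by unfold_locales (use assms in auto)
  let ?p = "\<lambda>Q. extension_prob (n + m) Q"
  show ?thesis
  proof (intro conjI allI ballI)
    fix r :: "nat \<Rightarrow> nat"
    let ?A = "\<lambda>\<Xi> Q. of_bool (\<forall>l\<in>{1..n+m}. has_sizes (\<Xi> l) (\<lambda>_. int l) Q) :: real"
    have "(\<integral>\<omega>. (\<Prod>l=1..n+m. falling_fact (real (num_old_blocks n m j B l (X \<omega>))) (r l))
          \<partial>conditional_law M X n (B ` {1..j})) =
        (\<Sum>Q\<in>extensions (n + m). (\<Prod>l=1..n+m. falling_fact (real (num_old_blocks n m j B l Q)) (r l)) * ?p Q)"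
      using integral_conditional_law[of "\<lambda>Q. \<Prod>l=1..n+m. falling_fact (real (num_old_blocks n m j B l Q)) (r l)" m]
      by (simp only: num_old_blocks_restrict)
    also have "\<dots> = (\<Sum>Q\<in>extensions (n + m). \<Sum>\<Xi>\<in>admissible_families (n + m) j B r.
        (\<Prod>l=1..n+m. fact (r l)) * (?A \<Xi> Q * ?p Q))"
      by (intro sum.cong refl)
        (simp only: prod_falling_fact_num_old_blocks sum_distrib_left sum_distrib_right mult.assoc)
    also have "\<dots> = (\<Prod>l=1..n+m. fact (r l)) * (\<Sum>\<Xi>\<in>admissible_families (n + m) j B r.
        \<Sum>Q\<in>extensions (n + m). ?A \<Xi> Q * ?p Q)"
      by (simp only: sum_distrib_left sum.swap[of _ "admissible_families (n + m) j B r"])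
    finally show "(\<integral>\<omega>. (\<Prod>l=1..n+m. falling_fact (real (num_old_blocks n m j B l (X \<omega>))) (r l))
          \<partial>conditional_law M X n (B ` {1..j})) =
       (\<Prod>l=1..n+m. fact (r l)) *
       (\<Sum>\<Xi>\<in>admissible_families (n + m) j B r.
          let N = int m - (\<Sum>l=1..n+m. int l * int (r l)) + (\<Sum>l=1..n+m. \<Sum>\<xi>\<in>\<Xi> l. int (card (B \<xi>)))
          in if N < 0 then 0 else
            fact m * (\<Prod>l=1..n+m. \<Prod>\<xi>\<in>\<Xi> l. pochhammer (real (card (B \<xi>)) - \<alpha>) (l - card (B \<xi>)))
            / ((\<Prod>l=1..n+m. \<Prod>\<xi>\<in>\<Xi> l. fact (l - card (B \<xi>))) * fact (nat N))
            * (\<Sum>k=0..nat N. V (n + m) (j + k) / V n j *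
                 noncentral_stirling \<alpha>
                   (- (real n - (real j - (\<Sum>l=1..n+m. real (r l))) * \<alpha>
                       - (\<Sum>l=1..n+m. \<Sum>\<xi>\<in>\<Xi> l. real (card (B \<xi>)))))
                   (nat N) k))"
    proof (simp only:, intro arg_cong2[where f = "(*)"] sum.cong refl)
      fix \<Xi> assume "\<Xi> \<in> admissible_families (n + m) j B r"
      then have adm: "\<And>l. l \<in> {1..n+m} \<Longrightarrow> \<Xi> l \<in> admissible j B l (r l)"
        and disj: "disjoint_family_on \<Xi> {1..n+m}"
        by (auto simp: admissible_families_def PiE_def)
      \<comment> \<open>A disjoint family amounts to one index set \<open>S\<close> with a
        prescribed size for each element: \<open>t i\<close> is the unique \<open>l\<close> whose
        set contains \<open>i\<close>.\<close>
      define S where "S = (\<Union>l\<in>{1..n+m}. \<Xi> l)"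
      define t where "t i = (THE l. l \<in> {1..n+m} \<and> i \<in> \<Xi> l)" for i
      have t: "t i = l" if "l \<in> {1..n+m}" "i \<in> \<Xi> l" for l i
        unfolding t_def using that disj
        by (intro the_equality conjI) (metis disjoint_family_onD IntI empty_iff)+
      have fin: "finite (\<Xi> l)" if "l \<in> {1..n+m}" for l
        using adm[OF that] finite_subset[of "\<Xi> l" "{1..j}"] by (simp add: admissible_def)
      have card: "card (\<Xi> l) = r l" if "l \<in> {1..n+m}" for l
        using adm[OF that] by (simp add: admissible_def)
      have S: "S \<subseteq> {1..j}"
        using adm unfolding S_def admissible_def by blast
      have le: "\<forall>i\<in>S. card (B i) \<le> t i"
      proof
        fix i assume i: "i \<in> S"
        obtain l where l: "l \<in> {1..n+m}" "i \<in> \<Xi> l"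
          using i unfolding S_def by blast
        then show "card (B i) \<le> t i"
          using adm[OF l(1)] t[OF l] by (auto simp: admissible_def)
      qed
      \<comment> \<open>The target type is left general, as both integer and real sums are split
        this way.\<close>
      have sumS: "sum g S = (\<Sum>l=1..n+m. sum g (\<Xi> l))" for g :: "nat \<Rightarrow> 'c::comm_monoid_add"
        unfolding S_def using fin disj
        by (intro sum.UNION_disjoint) (simp_all add: disjoint_family_on_def)
      have prodS: "(\<Prod>i\<in>S. g (t i) i) = (\<Prod>l=1..n+m. \<Prod>i\<in>\<Xi> l. g l i)"
        for g :: "nat \<Rightarrow> nat \<Rightarrow> real"
      proof -
        have "(\<Prod>i\<in>S. g (t i) i) = (\<Prod>l=1..n+m. \<Prod>i\<in>\<Xi> l. g (t i) i)"
          unfolding S_def using fin disj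
          by (intro prod.UNION_disjoint) (simp_all add: disjoint_family_on_def)
        also have "\<dots> = (\<Prod>l=1..n+m. \<Prod>i\<in>\<Xi> l. g l i)"
          by (intro prod.cong refl) (simp only: t)
        finally show ?thesis .
      qed
      have "(\<forall>l\<in>{1..n+m}. has_sizes (\<Xi> l) (\<lambda>_. int l) Q) \<longleftrightarrow> has_sizes S (\<lambda>i. int (t i)) Q" for Q
        unfolding has_sizes_def S_def by (auto simp del: atLeastAtMost_iff simp: t)
      then have sizes: "(\<Sum>Q\<in>extensions (n + m). ?A \<Xi> Q * ?p Q) =
          (\<Sum>Q\<in>extensions (n + m). of_bool (has_sizes S (\<lambda>i. int (t i)) Q) * ?p Q)"
        by simp
      have sum_t: "(\<Sum>i\<in>S. int (t i)) = (\<Sum>l=1..n+m. int l * int (r l))"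
      proof -
        have "(\<Sum>i\<in>S. int (t i)) = (\<Sum>l=1..n+m. \<Sum>i\<in>\<Xi> l. int l)"
          unfolding sumS by (intro sum.cong refl) (simp only: t)
        also have "\<dots> = (\<Sum>l=1..n+m. int l * int (r l))"
          by (intro sum.cong refl) (simp add: card mult.commute)
        finally show ?thesis .
      qed
      have card_S: "real (card S) = (\<Sum>l=1..n+m. real (r l))"
      proof -
        have "real (card S) = (\<Sum>l=1..n+m. real (card (\<Xi> l)))"
          using sumS[of "\<lambda>_. 1 :: real"] by simp
        also have "\<dots> = (\<Sum>l=1..n+m. real (r l))"
          by (intro sum.cong refl) (simp only: card)
        finally show ?thesis .
      qed
      show "(\<Sum>Q\<in>extensions (n + m). ?A \<Xi> Q * ?p Q) =
        (let N = int m - (\<Sum>l=1..n+m. int l * int (r l)) + (\<Sum>l=1..n+m. \<Sum>\<xi>\<in>\<Xi> l. int (card (B \<xi>)))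
          in if N < 0 then 0 else
            fact m * (\<Prod>l=1..n+m. \<Prod>\<xi>\<in>\<Xi> l. pochhammer (real (card (B \<xi>)) - \<alpha>) (l - card (B \<xi>)))
            / ((\<Prod>l=1..n+m. \<Prod>\<xi>\<in>\<Xi> l. fact (l - card (B \<xi>))) * fact (nat N))
            * (\<Sum>k=0..nat N. V (n + m) (j + k) / V n j *
                 noncentral_stirling \<alpha>
                   (- (real n - (real j - (\<Sum>l=1..n+m. real (r l))) * \<alpha>
                       - (\<Sum>l=1..n+m. \<Sum>\<xi>\<in>\<Xi> l. real (card (B \<xi>)))))
                   (nat N) k))"
        unfolding sizes sum_has_sizes_extension_prob[OF S le] Let_def sum_t card_S
        by (simp only: sumS
            prodS[of "\<lambda>l i. pochhammer (real (card (B i)) - \<alpha>) (l - card (B i))"]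
            prodS[of "\<lambda>l i. fact (l - card (B i))"])
    qed
  next
    \<comment> \<open>The single moment is computed directly in the same way, with one index set and
      the constant size \<open>l\<close>, instead of by specialising the sum over families.\<close>
    fix l r :: nat
    let ?A = "\<lambda>\<Xi> Q. of_bool (has_sizes \<Xi> (\<lambda>_. int l) Q) :: real"
    have "(\<integral>\<omega>. falling_fact (real (num_old_blocks n m j B l (X \<omega>))) r
          \<partial>conditional_law M X n (B ` {1..j})) =
        (\<Sum>Q\<in>extensions (n + m). falling_fact (real (num_old_blocks n m j B l Q)) r * ?p Q)"
      using integral_conditional_law[of "\<lambda>Q. falling_fact (real (num_old_blocks n m j B l Q)) r" m]
      by (simp only: num_old_blocks_restrict)
    also have "\<dots> = (\<Sum>Q\<in>extensions (n + m). \<Sum>\<Xi>\<in>admissible j B l r. fact r * (?A \<Xi> Q * ?p Q))"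
      by (intro sum.cong refl)
        (simp only: falling_fact_num_old_blocks sum_distrib_left sum_distrib_right mult.assoc)
    also have "\<dots> = fact r * (\<Sum>\<Xi>\<in>admissible j B l r. \<Sum>Q\<in>extensions (n + m). ?A \<Xi> Q * ?p Q)"
      by (simp only: sum_distrib_left sum.swap[of _ "admissible j B l r" "extensions (n + m)"])
    finally show "(\<integral>\<omega>. falling_fact (real (num_old_blocks n m j B l (X \<omega>))) r
          \<partial>conditional_law M X n (B ` {1..j})) =
       fact r *
       (\<Sum>\<Xi>\<in>admissible j B l r.
          let N = int m - int r * int l + (\<Sum>\<xi>\<in>\<Xi>. int (card (B \<xi>)))
          in if N < 0 then 0 else
            fact m * (\<Prod>\<xi>\<in>\<Xi>. pochhammer (real (card (B \<xi>)) - \<alpha>) (l - card (B \<xi>)))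
            / ((\<Prod>\<xi>\<in>\<Xi>. fact (l - card (B \<xi>))) * fact (nat N))
            * (\<Sum>k=0..nat N. V (n + m) (j + k) / V n j *
                 noncentral_stirling \<alpha>
                   (- (real n - (real j - real r) * \<alpha> - (\<Sum>\<xi>\<in>\<Xi>. real (card (B \<xi>)))))
                   (nat N) k))"
    proof (simp only:, intro arg_cong2[where f = "(*)"] sum.cong refl)
      fix \<Xi> assume \<Xi>: "\<Xi> \<in> admissible j B l r"
      then have "\<Xi> \<subseteq> {1..j}" "\<forall>i\<in>\<Xi>. card (B i) \<le> l" and card: "card \<Xi> = r"
        by (auto simp: admissible_def)
      note sum_has_sizes_extension_prob[OF this(1,2), of m]
      moreover have "(\<Sum>i\<in>\<Xi>. int l) = int r * int l"
        by (simp add: card)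
      ultimately show "(\<Sum>Q\<in>extensions (n + m). ?A \<Xi> Q * ?p Q) =
        (let N = int m - int r * int l + (\<Sum>\<xi>\<in>\<Xi>. int (card (B \<xi>)))
          in if N < 0 then 0 else
            fact m * (\<Prod>\<xi>\<in>\<Xi>. pochhammer (real (card (B \<xi>)) - \<alpha>) (l - card (B \<xi>)))
            / ((\<Prod>\<xi>\<in>\<Xi>. fact (l - card (B \<xi>))) * fact (nat N))
            * (\<Sum>k=0..nat N. V (n + m) (j + k) / V n j *
                 noncentral_stirling \<alpha>
                   (- (real n - (real j - real r) * \<alpha> - (\<Sum>\<xi>\<in>\<Xi>. real (card (B \<xi>)))))
                   (nat N) k))"
        by (simp only: Let_def card)
    qed
  qed
qed

end
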